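(* Let $k\colon R\to\mathbb{R}$ be a $W$-invariant multiplicity function with $k_\alpha>\frac12$ for all $\alpha\in R$, and let $\lambda\in\mathfrak{a}_{\mathrm{reg}}$. Then the representing measure $\mu_\lambda^k$ of the Dunkl kernel is absolutely continuous with respect to the Lebesgue measure on $\mathfrak{a}$, with density function belonging to $L^2(\mathfrak{a})$.
   Context: $(\mathfrak{a},\langle\cdot,\cdot\rangle)$ is a finite-dimensional Euclidean space; $\langle\cdot,\cdot\rangle$ is extended to a complex bilinear form on $\mathfrak{a}_{\mathbb{C}}=\mathbb{C}\otimes_{\mathbb{R}}\mathfrak{a}$. $R\subseteq\mathfrak{a}$ is a reduced root system spanning $\mathfrak{a}$ (a finite set of nonzero vectors, stable under all its reflections, with $R\cap\mathbb{R}\alpha=\{\pm\alpha\}$; the crystallographic condition is not imposed), normalized by $\langle\alpha,\alpha\rangle=2$ for all $\alpha\in R$. $W$ is the finite reflection group generated by $s_\alpha(x)=x-\langle\alpha,x\rangle\alpha$, $\alpha\in R$. $R_+\subseteq R$ is a fixed set of positive roots. $\mathfrak{a}_{\mathrm{reg}}=\{x\in\mathfrak{a}:\langle\alpha,x\rangle\ne0\ \forall\alpha\in R\}$. For a $W$-invariant $k\colon R\to\mathbb{C}$, the Dunkl operator in direction $\xi\in\mathfrak{a}$ is $T_\xi=\partial_\xi+\sum_{\alpha\in R_+}k_\alpha\langle\alpha,\xi\rangle\frac{1-s_\alpha}{\langle\alpha,\cdot\rangle}$, where $(s_\alpha f)(x)=f(s_\alpha x)$. If $\operatorname{Re}k\ge0$,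 the Dunkl kernel $\operatorname{Exp}_k\colon\mathfrak{a}_{\mathbb{C}}\times\mathfrak{a}_{\mathbb{C}}\to\mathbb{C}$ is the unique holomorphic function such that for every $\lambda\in\mathfrak{a}_{\mathbb{C}}$, $f=\operatorname{Exp}_k(\lambda,\cdot)$ is the unique solution of $T_\xi f=\langle\xi,\lambda\rangle f$ for all $\xi\in\mathfrak{a}$, $f(0)=1$. Representing measure: for real $k\ge0$ and $\lambda\in\mathfrak{a}$ there is (known theorem of Rösler) a unique compactly supported probability measure $\mu_\lambda^k$ on $\mathfrak{a}$ with $\operatorname{Exp}_k(\lambda,z)=\int_{\mathfrak{a}}e^{\langle z,\xi\rangle}\,d\mu_\lambda^k(\xi)$ for all $z\in\mathfrak{a}_{\mathbb{C}}$. *)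

theory Defs
  imports "HOL-Probability.Probability"
begin

text \<open>This is the orthogonal reflection along \<open>\<alpha>\<close> only for \<open>\<alpha> \<bullet> \<alpha> = 2\<close>, the normalization imposed on
  root systems below. No crystallographic condition is imposed.\<close>

definition root_reflect :: "'a::euclidean_space \<Rightarrow> 'a \<Rightarrow> 'a" where
  "root_reflect \<alpha> x = x - (\<alpha> \<bullet> x) *\<^sub>R \<alpha>"

definition normalized_root_system :: "'a::euclidean_space set \<Rightarrow> bool" where
  "normalized_root_system R \<longleftrightarrow>
     finite R \<and> 0 \<notin> R \<and> span R = UNIV \<and>
     (\<forall>\<alpha>\<in>R. root_reflect \<alpha> ` R = R) \<and>
     (\<forall>\<alpha>\<in>R. R \<inter> range (\<lambda>c. c *\<^sub>R \<alpha>) = {\<alpha>, - \<alpha>}) \<and>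
     (\<forall>\<alpha>\<in>R. \<alpha> \<bullet> \<alpha> = 2)"

definition positive_system :: "'a::euclidean_space set \<Rightarrow> 'a set \<Rightarrow> bool" where
  "positive_system R P \<longleftrightarrow>
     (\<exists>v. (\<forall>\<alpha>\<in>R. \<alpha> \<bullet> v \<noteq> 0) \<and> P = {\<alpha>\<in>R. \<alpha> \<bullet> v > 0})"

text \<open>Reflections are involutions, so closure under composition with generators already
  gives the generated group.\<close>

inductive_set reflection_group :: "'a::euclidean_space set \<Rightarrow> ('a \<Rightarrow> 'a) set"
  for R :: "'a set" where
  id: "id \<in> reflection_group R"
| refl: "\<lbrakk>w \<in> reflection_group R; \<alpha> \<in> R\<rbrakk> \<Longrightarrow> root_reflect \<alpha> \<circ> w \<in> reflection_group R"

definition multiplicity_function :: "'a::euclidean_space set \<Rightarrow> ('a \<Rightarrow> 'b) \<Rightarrow> bool" where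
  "multiplicity_function R k \<longleftrightarrow> (\<forall>w\<in>reflection_group R. \<forall>\<alpha>\<in>R. k (w \<alpha>) = k \<alpha>)"

definition regular_points :: "'a::euclidean_space set \<Rightarrow> 'a set" where
  "regular_points R = {x. \<forall>\<alpha>\<in>R. \<alpha> \<bullet> x \<noteq> 0}"

text \<open>The complexification of a Euclidean space \<open>'a\<close>: the pair \<open>(x, y)\<close> stands for \<open>x + \<i> y\<close>.\<close>

type_synonym 'a cplxn = "'a \<times> 'a"

definition of_real_vec :: "'a::euclidean_space \<Rightarrow> 'a cplxn" where
  "of_real_vec x = (x, 0)"

definition mult_ii :: "'a::euclidean_space cplxn \<Rightarrow> 'a cplxn" where
  "mult_ii z = (- snd z, fst z)"

text \<open>The complex bilinear (not sesquilinear) extension of the inner product.\<close>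

definition cform :: "'a::euclidean_space cplxn \<Rightarrow> 'a cplxn \<Rightarrow> complex" where
  "cform z w = Complex (fst z \<bullet> fst w - snd z \<bullet> snd w) (fst z \<bullet> snd w + snd z \<bullet> fst w)"

definition creflect :: "'a::euclidean_space \<Rightarrow> 'a cplxn \<Rightarrow> 'a cplxn" where
  "creflect \<alpha> = map_prod (root_reflect \<alpha>) (root_reflect \<alpha>)"

text \<open>Holomorphy on a complex vector space whose multiplication by \<open>\<i>\<close> is \<open>J\<close>: the real
  Frechet derivative exists everywhere and is complex linear.\<close>

definition entire_wrt :: "('v::real_normed_vector \<Rightarrow> 'v) \<Rightarrow> ('v \<Rightarrow> complex) \<Rightarrow> bool" where
  "entire_wrt J F \<longleftrightarrow>
     (\<forall>p. \<exists>D. (F has_derivative D) (at p) \<and> (\<forall>v. D (J v) = \<i> * D v))"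

definition dir_deriv :: "'a::euclidean_space \<Rightarrow> ('a cplxn \<Rightarrow> complex) \<Rightarrow> 'a cplxn \<Rightarrow> complex" where
  "dir_deriv \<xi> f z = frechet_derivative f (at z) (of_real_vec \<xi>)"

text \<open>The quotient \<open>(f - s\<^sub>\<alpha> f) / \<langle>\<alpha>, \<cdot>\<rangle>\<close>. For holomorphic \<open>f\<close> and \<open>\<alpha> \<bullet> \<alpha> = 2\<close>, its singularity
  along the hyperplane \<open>\<langle>\<alpha>, z\<rangle> = 0\<close> is removable; since \<open>s\<^sub>\<alpha> z = z - \<langle>\<alpha>, z\<rangle> \<alpha>\<close>, the value of the
  extension there is the derivative of \<open>f\<close> in direction \<open>\<alpha>\<close>.\<close>

definition difference_quotient ::
    "'a::euclidean_space \<Rightarrow> ('a cplxn \<Rightarrow> complex) \<Rightarrow> 'a cplxn \<Rightarrow> complex" where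
  "difference_quotient \<alpha> f z =
     (if cform (of_real_vec \<alpha>) z = 0 then dir_deriv \<alpha> f z
      else (f z - f (creflect \<alpha> z)) / cform (of_real_vec \<alpha>) z)"

definition dunkl_operator ::
    "'a::euclidean_space set \<Rightarrow> ('a \<Rightarrow> complex) \<Rightarrow> 'a \<Rightarrow>
     ('a cplxn \<Rightarrow> complex) \<Rightarrow> 'a cplxn \<Rightarrow> complex" where
  "dunkl_operator P k \<xi> f z =
     dir_deriv \<xi> f z +
     (\<Sum>\<alpha>\<in>P. k \<alpha> * complex_of_real (\<alpha> \<bullet> \<xi>) * difference_quotient \<alpha> f z)"

text \<open>The first argument of \<open>E\<close> is the spectral parameter. For \<open>Re k \<ge> 0\<close> there is exactly one
  such \<open>E\<close>.\<close>

definition is_dunkl_kernel ::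
    "'a::euclidean_space set \<Rightarrow> ('a \<Rightarrow> complex) \<Rightarrow> ('a cplxn \<Rightarrow> 'a cplxn \<Rightarrow> complex) \<Rightarrow> bool" where
  "is_dunkl_kernel P k E \<longleftrightarrow>
     entire_wrt (map_prod mult_ii mult_ii) (\<lambda>(l, z). E l z) \<and>
     (\<forall>l. (\<forall>\<xi> z. dunkl_operator P k \<xi> (E l) z = cform (of_real_vec \<xi>) l * E l z) \<and> E l 0 = 1)"

text \<open>For real \<open>k \<ge> 0\<close> and the Dunkl kernel \<open>E\<close>, there is exactly one such \<open>\<mu>\<close> for each
  real spectral parameter \<open>l\<close>.\<close>

definition is_representing_measure ::
    "('a::euclidean_space cplxn \<Rightarrow> 'a cplxn \<Rightarrow> complex) \<Rightarrow> 'a \<Rightarrow> 'a measure \<Rightarrow> bool" where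
  "is_representing_measure E l \<mu> \<longleftrightarrow>
     prob_space \<mu> \<and> sets \<mu> = sets borel \<and>
     (\<exists>K. compact K \<and> emeasure \<mu> (- K) = 0) \<and>
     (\<forall>z. E (of_real_vec l) z = (\<integral>\<xi>. exp (cform z (of_real_vec \<xi>)) \<partial>\<mu>))"

end

theory Submission
  imports Defs
begin

text \<open>By Plancherel it suffices that \<open>y \<mapsto> E(l, i y)\<close>, the Fourier transform of \<open>\<mu>\<close>, is square
  integrable. Along a ray \<open>t \<mapsto> i t x\<close> the functions \<open>u\<^sub>w(t) = E(l, i t w x)\<close>, indexed by the reflection
  group, solve the linear system
  \<open>u\<^sub>w' = i \<langle>w x, l\<rangle> u\<^sub>w - (1 / 2t) \<Sum>\<^sub>\<alpha> k\<^sub>\<alpha> (u\<^sub>w - u\<^sub>s\<^sub>\<alpha>\<^sub>w)\<close> with \<open>\<alpha>\<close> ranging over all roots.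
  Each root \<open>\<alpha>\<close> contributes to \<open>\<Sum> |u\<^sub>w|\<^sup>2\<close> a decay of order \<open>t\<close> to the power \<open>- k\<^sub>\<alpha>\<close> as soon as \<open>t \<bar>\<langle>\<alpha>, x\<rangle>\<bar>\<close>
  is large: since \<open>l\<close> is regular, the cross terms \<open>cnj u\<^sub>w u\<^sub>s\<^sub>\<alpha>\<^sub>w\<close> oscillate with the nonzero frequency
  \<open>\<langle>\<alpha>, l\<rangle> \<langle>\<alpha>, w x\<rangle>\<close>, and one integration by parts removes them with an error bounded uniformly in \<open>x\<close>.
  The resulting bound on \<open>|E(l, i x)|\<^sup>2\<close> is, up to a constant, the product over all roots \<open>\<alpha>\<close> of \<open>1 + (\<langle>\<alpha>, x\<rangle> / A)\<^sup>2\<close> to the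
  power \<open>- k\<^sub>\<alpha> / 2\<close>; it is integrable for \<open>k > 1/2\<close> because \<open>R\<close> contains \<open>\<plusminus>B\<close> for a basis \<open>B\<close>.\<close>

section \<open>Decay of oscillating Fuchsian systems\<close>

text \<open>The proof builds from the energy \<open>N\<close>, the sum of all
  \<open>(norm (u w t))\<^sup>2\<close>, a weighted quantity \<open>\<Lambda>\<close> that does not
  increase on the unit interval. The reflection terms dissipate \<open>N\<close> up to the cross
  terms \<open>p\<close>, which rotate with frequency \<open>c \<alpha> * b \<alpha> w\<close> and
  are therefore integrated by parts. \<open>A\<close> and \<open>D\<close> depend only on
  \<open>K\<close>, \<open>M\<close> and \<open>card W\<close>, so the estimate is uniform in the
  numbers \<open>a \<alpha>\<close>.\<close>

lemma oscillatory_system_decay: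
  fixes W :: "'w set" and R :: "'r set" and k c a :: "'r \<Rightarrow> real" and s :: "'r \<Rightarrow> 'w \<Rightarrow> 'w"
    and b :: "'r \<Rightarrow> 'w \<Rightarrow> real" and \<theta> :: "'w \<Rightarrow> real" and u :: "'w \<Rightarrow> real \<Rightarrow> complex"
    and A M K D :: real
  assumes fin: "finite W" "finite R"
    and k: "\<And>\<alpha>. \<alpha> \<in> R \<Longrightarrow> 0 \<le> k \<alpha>"
    and c: "\<And>\<alpha>. \<alpha> \<in> R \<Longrightarrow> 1 \<le> M * \<bar>c \<alpha>\<bar>" and M: "0 \<le> M"
    and s: "\<And>\<alpha> w. \<alpha> \<in> R \<Longrightarrow> w \<in> W \<Longrightarrow> s \<alpha> w \<in> W"
    and ss: "\<And>\<alpha> w. \<alpha> \<in> R \<Longrightarrow> w \<in> W \<Longrightarrow> s \<alpha> (s \<alpha> w) = w"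
    and b: "\<And>\<alpha> w. \<alpha> \<in> R \<Longrightarrow> w \<in> W \<Longrightarrow> b \<alpha> (s \<alpha> w) = - b \<alpha> w"
    and \<theta>: "\<And>\<alpha> w. \<alpha> \<in> R \<Longrightarrow> w \<in> W \<Longrightarrow> \<theta> w - \<theta> (s \<alpha> w) = c \<alpha> * b \<alpha> w"
    and inv: "\<And>h w. w \<in> W \<Longrightarrow> (\<Sum>\<alpha>\<in>R. k \<alpha> * h (b \<alpha> w)) = (\<Sum>\<alpha>\<in>R. k \<alpha> * h (a \<alpha>))"
    and cont: "\<And>w. w \<in> W \<Longrightarrow> continuous_on {0..1} (u w)"
    and deriv: "\<And>w t. w \<in> W \<Longrightarrow> 0 < t \<Longrightarrow> t < 1 \<Longrightarrow>
      (u w has_vector_derivative (\<i> * \<theta> w * u w t -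
         (1 / (2 * complex_of_real t)) * (\<Sum>\<alpha>\<in>R. k \<alpha> * (u w t - u (s \<alpha> w) t)))) (at t)"
    and init: "\<And>w. w \<in> W \<Longrightarrow> norm (u w 0) = 1"
    and K: "K = (\<Sum>\<alpha>\<in>R. k \<alpha>)" and A: "A = 1 + K * M * card W"
    and D: "D = 2 * M * (3 * K + 1) * card W"
    and w0: "w0 \<in> W"
  shows "(norm (u w0 1))\<^sup>2 \<le> 2 * card W * exp (D * K * pi / (2 * A)) *
    exp (- (\<Sum>\<alpha>\<in>R. k \<alpha> / 2 * ln (1 + (a \<alpha> / A)\<^sup>2)))"
proof -
  have K0: "K \<ge> 0" unfolding K by (simp add: k sum_nonneg)
  have A1: "A \<ge> 1" unfolding A using K0 M by simp
  have D0: "D \<ge> 0" unfolding D using K0 M by simp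
  define N where "N = (\<lambda>t. \<Sum>w\<in>W. (norm (u w t))\<^sup>2)"
  define p where "p = (\<lambda>\<alpha> w t. cnj (u w t) * u (s \<alpha> w) t)"
  \<comment> \<open>Amplitude for the integration by parts: it vanishes at \<open>t = 0\<close>, and
    \<open>y * \<psi> t y\<close> behaves like \<open>1 / t\<close> once
    \<open>t * \<bar>y\<bar>\<close> is large compared with \<open>A\<close>.\<close>
  define \<psi> where "\<psi> = (\<lambda>t y::real. t * y / (A\<^sup>2 + t\<^sup>2 * y\<^sup>2))"
  \<comment> \<open>This majorizes both \<open>\<bar>\<psi> t y\<bar> / t\<close> and the derivative
    of \<open>\<psi>\<close> in \<open>t\<close>. Over all positive \<open>t\<close> it integrates
    to \<open>pi / (2 * A)\<close> for every nonzero \<open>y\<close>, so the errors stay bounded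
    however large \<open>y\<close> is.\<close>
  define e where "e = (\<lambda>t y::real. \<bar>y\<bar> / (A\<^sup>2 + t\<^sup>2 * y\<^sup>2))"
  \<comment> \<open>\<open>S\<close> is the boundary term of the integration by parts. The factor \<open>A\<close> makes \<open>\<bar>S\<bar> \<le> N / 2\<close>, so that
    \<open>N - S\<close> is comparable to the energy \<open>N\<close>.\<close>
  define S where "S = (\<lambda>t. - (\<Sum>w\<in>W. \<Sum>\<alpha>\<in>R. k \<alpha> / c \<alpha> * \<psi> t (b \<alpha> w) * Im (p \<alpha> w t)))"
  \<comment> \<open>Exponent of the decay to be proved, zero at \<open>t = 0\<close>;
    \<open>g'\<close> is its derivative.\<close>
  define g where "g = (\<lambda>t. \<Sum>\<alpha>\<in>R. k \<alpha> / 2 * ln (1 + (t * a \<alpha> / A)\<^sup>2))"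
  define g' where "g' = (\<lambda>t. \<Sum>\<alpha>\<in>R. k \<alpha> * (t * (a \<alpha>)\<^sup>2 / (A\<^sup>2 + t\<^sup>2 * (a \<alpha>)\<^sup>2)))"
  \<comment> \<open>\<open>J / A\<close> is the antiderivative of the error rate \<open>J'\<close>
    that vanishes at 0.\<close>
  define J where "J = (\<lambda>t. \<Sum>\<alpha>\<in>R. k \<alpha> * arctan (t * \<bar>a \<alpha>\<bar> / A))"
  define J' where "J' = (\<lambda>t. \<Sum>\<alpha>\<in>R. k \<alpha> * e t (a \<alpha>))"
  define v where "v = (\<lambda>w t. \<Sum>\<alpha>\<in>R. k \<alpha> * (u w t - u (s \<alpha> w) t))"
  define \<psi>' where "\<psi>' = (\<lambda>t y::real. y * (A\<^sup>2 - t\<^sup>2 * y\<^sup>2) / (A\<^sup>2 + t\<^sup>2 * y\<^sup>2)\<^sup>2)"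
  have pos: "A\<^sup>2 + t\<^sup>2 * y\<^sup>2 > 0" for t y
    using A1 by (simp add: add_pos_nonneg)
  have inv_c: "\<bar>1 / c \<alpha>\<bar> \<le> M" "c \<alpha> \<noteq> 0" if "\<alpha> \<in> R" for \<alpha>
  proof -
    show "c \<alpha> \<noteq> 0" using c[OF that] by auto
    then show "\<bar>1 / c \<alpha>\<bar> \<le> M" using c[OF that] by (simp add: abs_divide divide_le_eq)
  qed
  have N0: "N t \<ge> 0" for t unfolding N_def by (simp add: sum_nonneg)
  have uN: "(norm (u w t))\<^sup>2 \<le> N t" if "w \<in> W" for w t
    unfolding N_def using fin that by (intro member_le_sum) auto
  have uu: "norm (u w t) * norm (u w' t) \<le> N t" if "w \<in> W" "w' \<in> W" for w w' t
  proof -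
    have "2 * (norm (u w t) * norm (u w' t)) \<le> (norm (u w t))\<^sup>2 + (norm (u w' t))\<^sup>2"
      using sum_squares_bound[of "norm (u w t)" "norm (u w' t)"] by simp
    with uN[OF that(1), of t] uN[OF that(2), of t] show ?thesis by linarith
  qed
  have pN: "norm (p \<alpha> w t) \<le> N t" if "\<alpha> \<in> R" "w \<in> W" for \<alpha> w t
    unfolding p_def using uu[OF that(2) s[OF that]] by (simp add: norm_mult)
  have vN: "norm (v w t) * norm (u w' t) \<le> 2 * K * N t" if "w \<in> W" "w' \<in> W" for w w' t
  proof -
    have "norm (v w t) \<le> (\<Sum>\<alpha>\<in>R. k \<alpha> * (norm (u w t) + norm (u (s \<alpha> w) t)))"
      unfolding v_def by (intro sum_norm_le) (auto simp: norm_mult k intro!: mult_left_mono norm_triangle_ineq4)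
    then have "norm (v w t) * norm (u w' t) \<le>
        (\<Sum>\<alpha>\<in>R. k \<alpha> * (norm (u w t) + norm (u (s \<alpha> w) t))) * norm (u w' t)"
      by (intro mult_right_mono) auto
    also have "\<dots> = (\<Sum>\<alpha>\<in>R. k \<alpha> * (norm (u w t) * norm (u w' t) + norm (u (s \<alpha> w) t) * norm (u w' t)))"
      unfolding sum_distrib_right by (intro sum.cong) (auto simp: algebra_simps)
    also have "\<dots> \<le> (\<Sum>\<alpha>\<in>R. k \<alpha> * (N t + N t))"
      using that by (intro sum_mono mult_left_mono add_mono uu k s) auto
    also have "\<dots> = 2 * K * N t" unfolding K sum_distrib_right sum_distrib_left by (intro sum.cong) auto
    finally show ?thesis .
  qed

  \<comment> \<open>Derivatives of the solutions, the cross terms and the energy\<close>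
  have du: "(u w has_vector_derivative (\<i> * \<theta> w * u w t - (1 / (2 * complex_of_real t)) * v w t)) (at t)"
    if "w \<in> W" "0 < t" "t < 1" for w t
    using deriv[OF that] unfolding v_def .
  \<comment> \<open>Reflection part of the derivative of \<open>p\<close>, with the singular factor
    \<open>1 / t\<close> taken out.\<close>
  define q where "q = (\<lambda>\<alpha> w t. - (cnj (v w t) * u (s \<alpha> w) t + cnj (u w t) * v (s \<alpha> w) t) / 2)"
  have qN: "norm (q \<alpha> w t) \<le> 2 * K * N t" if "\<alpha> \<in> R" "w \<in> W" for \<alpha> w t
  proof -
    have "norm (q \<alpha> w t) = norm (cnj (v w t) * u (s \<alpha> w) t + cnj (u w t) * v (s \<alpha> w) t) / 2"
      unfolding q_def by (simp only: norm_divide norm_minus_cancel norm_numeral)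
    also have "\<dots> \<le> (norm (cnj (v w t) * u (s \<alpha> w) t) + norm (cnj (u w t) * v (s \<alpha> w) t)) / 2"
      by (intro divide_right_mono norm_triangle_ineq) auto
    also have "\<dots> = (norm (v w t) * norm (u (s \<alpha> w) t) + norm (v (s \<alpha> w) t) * norm (u w t)) / 2"
      by (simp only: norm_mult complex_mod_cnj mult.commute)
    also have "\<dots> \<le> (2 * K * N t + 2 * K * N t) / 2"
      using that s by (intro divide_right_mono add_mono vN) auto
    finally show ?thesis by simp
  qed
  have dp: "(p \<alpha> w has_vector_derivative (- \<i> * (c \<alpha> * b \<alpha> w) * p \<alpha> w t + (1 / complex_of_real t) * q \<alpha> w t)) (at t)"
    if "\<alpha> \<in> R" "w \<in> W" "0 < t" "t < 1" for \<alpha> w t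
  proof -
    note d1 = du[OF that(2-4)] and d2 = du[OF s[OF that(1,2)] that(3,4)]
    have d1': "((\<lambda>t. cnj (u w t)) has_vector_derivative cnj (\<i> * \<theta> w * u w t - (1 / (2 * complex_of_real t)) * v w t)) (at t)"
      by (rule has_vector_derivative_cnj[OF d1])
    have e1: "c \<alpha> * b \<alpha> w = \<theta> w - \<theta> (s \<alpha> w)" using \<theta>[OF that(1,2)] by simp
    show ?thesis
      unfolding p_def
      by (rule has_vector_derivative_eq_rhs[OF has_vector_derivative_mult[OF d1' d2]])
        (use that in \<open>simp add: e1 q_def field_simps\<close>)
  qed
  \<comment> \<open>The term with \<open>\<theta> w\<close> only rotates \<open>u w\<close> and
    leaves its norm unchanged, so the reflection terms alone contribute.\<close>
  have dN: "(N has_real_derivative (- (1 / t) * (\<Sum>w\<in>W. \<Sum>\<alpha>\<in>R. k \<alpha> * ((norm (u w t))\<^sup>2 - Re (p \<alpha> w t))))) (at t)"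
    if "0 < t" "t < 1" for t
  proof -
    have "((\<lambda>t. (norm (u w t))\<^sup>2) has_real_derivative
        (- (1 / t) * (\<Sum>\<alpha>\<in>R. k \<alpha> * ((norm (u w t))\<^sup>2 - Re (p \<alpha> w t))))) (at t)" if w: "w \<in> W" for w
    proof -
      note d1 = du[OF w \<open>0 < t\<close> \<open>t < 1\<close>]
      have eq: "(\<lambda>t. (norm (u w t))\<^sup>2) = (\<lambda>t. u w t \<bullet> u w t)" by (simp add: power2_norm_eq_inner)
      have "((\<lambda>t. u w t \<bullet> u w t) has_vector_derivative
         (u w t \<bullet> (\<i> * \<theta> w * u w t - (1 / (2 * complex_of_real t)) * v w t) + (\<i> * \<theta> w * u w t - (1 / (2 * complex_of_real t)) * v w t) \<bullet> u w t)) (at t)"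
        by (rule bounded_bilinear.has_vector_derivative[OF bounded_bilinear_inner d1 d1])
      moreover have "u w t \<bullet> (\<i> * \<theta> w * u w t - (1 / (2 * complex_of_real t)) * v w t) = - (1 / (2 * t)) * (u w t \<bullet> v w t)"
      proof -
        have "(1 / (2 * complex_of_real t)) * v w t = (1 / (2 * t)) *\<^sub>R v w t"
          by (simp add: scaleR_conv_of_real)
        moreover have "u w t \<bullet> (\<i> * \<theta> w * u w t) = 0"
          by (simp add: inner_complex_def algebra_simps)
        ultimately show ?thesis by (simp add: inner_diff_right)
      qed
      moreover have "u w t \<bullet> v w t = (\<Sum>\<alpha>\<in>R. k \<alpha> * ((norm (u w t))\<^sup>2 - Re (p \<alpha> w t)))"
        unfolding v_def inner_sum_right
        by (intro sum.cong) (unfold p_def inner_complex_def cmod_power2, auto simp: power2_eq_square algebra_simps)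
      ultimately show ?thesis
        unfolding eq has_real_derivative_iff_has_vector_derivative
        by (simp add: inner_commute)
    qed
    then have "(N has_real_derivative (\<Sum>w\<in>W. (- (1 / t) * (\<Sum>\<alpha>\<in>R. k \<alpha> * ((norm (u w t))\<^sup>2 - Re (p \<alpha> w t)))))) (at t)"
      unfolding N_def by (rule DERIV_sum)
    then show ?thesis by (simp only: sum_distrib_left)
  qed
  have bd_\<psi>: "\<bar>\<psi> t y\<bar> \<le> 1 / (2 * A)" for t y
  proof -
    have "2 * (A * \<bar>t * y\<bar>) \<le> A\<^sup>2 + t\<^sup>2 * y\<^sup>2"
      using sum_squares_bound[of A "\<bar>t * y\<bar>"] by (simp add: power_mult_distrib)
    then show ?thesis
      using pos[of t y] A1 unfolding \<psi>_def by (simp add: field_simps abs_mult)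
  qed
  have \<psi>_e: "\<bar>\<psi> t y\<bar> = t * e t y" if "t > 0" for t y
    using pos[of t y] that unfolding \<psi>_def e_def by (simp add: abs_mult)
  have bd_\<psi>': "\<bar>\<psi>' t y\<bar> \<le> e t y" for t y
  proof -
    have "\<bar>y\<bar> * \<bar>A\<^sup>2 - t\<^sup>2 * y\<^sup>2\<bar> \<le> \<bar>y\<bar> * (A\<^sup>2 + t\<^sup>2 * y\<^sup>2)"
      by (intro mult_left_mono) (auto simp: abs_le_iff)
    then have "\<bar>\<psi>' t y\<bar> \<le> (\<bar>y\<bar> * (A\<^sup>2 + t\<^sup>2 * y\<^sup>2)) / (A\<^sup>2 + t\<^sup>2 * y\<^sup>2)\<^sup>2"
      unfolding \<psi>'_def by (simp add: abs_mult divide_right_mono)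
    also have "\<dots> = e t y" using pos[of t y] unfolding e_def by (simp add: power2_eq_square)
    finally show ?thesis .
  qed
  have e0: "e t y \<ge> 0" for t y using pos[of t y] unfolding e_def by simp
  have d\<psi>: "((\<lambda>t. \<psi> t y) has_real_derivative \<psi>' t y) (at t)" for t y
    unfolding \<psi>_def \<psi>'_def using pos[of t y]
    by (auto intro!: derivative_eq_intros simp: field_simps power2_eq_square)
  have kc: "\<bar>k \<alpha> / c \<alpha>\<bar> \<le> k \<alpha> * M" if "\<alpha> \<in> R" for \<alpha>
    using mult_left_mono[OF inv_c(1)[OF that] k[OF that]] k[OF that] by (simp add: abs_mult)
  define err where "err = (\<lambda>t. \<Sum>w\<in>W. \<Sum>\<alpha>\<in>R. k \<alpha> / c \<alpha> *
      (\<psi>' t (b \<alpha> w) * Im (p \<alpha> w t) + \<psi> t (b \<alpha> w) * Im (q \<alpha> w t) / t))"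
  \<comment> \<open>Regularization of the dissipation rate \<open>1 / t\<close>: it never exceeds
    \<open>1 / t\<close> and has no singularity at 0. Its sum against \<open>k\<close> is
    \<open>g'\<close>.\<close>
  define r where "r = (\<lambda>t y::real. t * y\<^sup>2 / (A\<^sup>2 + t\<^sup>2 * y\<^sup>2))"
  \<comment> \<open>The rotation of \<open>p\<close> puts
    \<open>- c \<alpha> * b \<alpha> w * Re (p \<alpha> w t)\<close> into the derivative of the
    imaginary part. The factor \<open>- \<psi> / c\<close> turns this into \<open>r\<close> times
    the real part of \<open>p\<close>; what remains is \<open>err\<close>.\<close>
  have dS: "(S has_real_derivative ((\<Sum>w\<in>W. \<Sum>\<alpha>\<in>R. k \<alpha> * (r t (b \<alpha> w) * Re (p \<alpha> w t))) - err t)) (at t)"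
    if "0 < t" "t < 1" for t
  proof -
    have *: "((\<lambda>t. k \<alpha> / c \<alpha> * \<psi> t (b \<alpha> w) * Im (p \<alpha> w t)) has_real_derivative
       (k \<alpha> / c \<alpha> * (\<psi>' t (b \<alpha> w) * Im (p \<alpha> w t) + \<psi> t (b \<alpha> w) * Im (q \<alpha> w t) / t) -
         k \<alpha> * (r t (b \<alpha> w) * Re (p \<alpha> w t)))) (at t)"
      if "\<alpha> \<in> R" "w \<in> W" for \<alpha> w
    proof -
      have "((\<lambda>t. Im (p \<alpha> w t)) has_real_derivative
          Im (- \<i> * (c \<alpha> * b \<alpha> w) * p \<alpha> w t + (1 / complex_of_real t) * q \<alpha> w t)) (at t)"
        unfolding has_real_derivative_iff_has_vector_derivative
        by (rule bounded_linear.has_vector_derivative[OF bounded_linear_Im dp[OF that \<open>0 < t\<close> \<open>t < 1\<close>]])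
      also have "Im (- \<i> * (c \<alpha> * b \<alpha> w) * p \<alpha> w t + (1 / complex_of_real t) * q \<alpha> w t) =
          - (c \<alpha> * b \<alpha> w * Re (p \<alpha> w t)) + Im (q \<alpha> w t) / t"
        by (simp add: Im_divide_of_real)
      finally have "((\<lambda>t. k \<alpha> / c \<alpha> * (\<psi> t (b \<alpha> w) * Im (p \<alpha> w t))) has_real_derivative
         (k \<alpha> / c \<alpha> * (\<psi>' t (b \<alpha> w) * Im (p \<alpha> w t) +
            (- (c \<alpha> * b \<alpha> w * Re (p \<alpha> w t)) + Im (q \<alpha> w t) / t) * \<psi> t (b \<alpha> w)))) (at t)"
        by (intro DERIV_cmult DERIV_mult d\<psi>)
      moreover have "r t (b \<alpha> w) = b \<alpha> w * \<psi> t (b \<alpha> w)"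
        unfolding r_def \<psi>_def by (simp add: power2_eq_square)
      ultimately show ?thesis
        using inv_c(2)[OF that(1)] by (simp add: field_simps)
    qed
    show ?thesis
      unfolding S_def
      by (rule DERIV_cong[OF DERIV_minus[OF DERIV_sum[OF DERIV_sum[OF *]]]])
        (auto simp: err_def sum_subtractf)
  qed
  have g'_r: "(\<Sum>\<alpha>\<in>R. k \<alpha> * r t (b \<alpha> w)) = g' t" if "w \<in> W" for w t
    unfolding g'_def r_def using inv[OF that, of "\<lambda>y. t * y\<^sup>2 / (A\<^sup>2 + t\<^sup>2 * y\<^sup>2)"] by simp
  have J'_e: "(\<Sum>\<alpha>\<in>R. k \<alpha> * e t (b \<alpha> w)) = J' t" if "w \<in> W" for w t
    unfolding J'_def using inv[OF that, of "e t"] by simp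
  have r_le: "r t y \<le> 1 / t" if "t > 0" for t y
    using pos[of t y] that unfolding r_def by (simp add: field_simps power2_eq_square)
  \<comment> \<open>The single terms may be negative, so \<open>1 / t\<close> can be lowered to
    \<open>r\<close> only in the sum over \<open>W\<close>. The weight is invariant under
    \<open>s \<alpha>\<close>, and symmetrizing replaces
    \<open>(norm (u w t))\<^sup>2 - Re (p \<alpha> w t)\<close> by half of
    \<open>(norm (u w t - u (s \<alpha> w) t))\<^sup>2\<close>.\<close>
  have diss: "(\<Sum>w\<in>W. \<Sum>\<alpha>\<in>R. k \<alpha> * (r t (b \<alpha> w) * ((norm (u w t))\<^sup>2 - Re (p \<alpha> w t)))) \<le>
      1 / t * (\<Sum>w\<in>W. \<Sum>\<alpha>\<in>R. k \<alpha> * ((norm (u w t))\<^sup>2 - Re (p \<alpha> w t)))" if "t > 0" for t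
  proof -
    have "0 \<le> (\<Sum>w\<in>W. (1 / t - r t (b \<alpha> w)) * ((norm (u w t))\<^sup>2 - Re (p \<alpha> w t)))"
      if \<alpha>: "\<alpha> \<in> R" for \<alpha>
    proof -
      define \<eta> where "\<eta> = (\<lambda>w. 1 / t - r t (b \<alpha> w))"
      have \<eta>0: "\<eta> w \<ge> 0" for w unfolding \<eta>_def using r_le[OF \<open>t > 0\<close>] by simp
      have \<eta>s: "\<eta> (s \<alpha> w) = \<eta> w" if "w \<in> W" for w
        unfolding \<eta>_def r_def using b[OF \<alpha> that] by simp
      have "(\<Sum>w\<in>W. \<eta> w * (norm (u (s \<alpha> w) t))\<^sup>2) = (\<Sum>w\<in>W. \<eta> w * (norm (u w t))\<^sup>2)"
        by (rule sum.reindex_bij_witness[of _ "s \<alpha>" "s \<alpha>"]) (auto simp: s ss \<alpha> \<eta>s)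
      then have "2 * (\<Sum>w\<in>W. \<eta> w * ((norm (u w t))\<^sup>2 - Re (p \<alpha> w t))) =
          (\<Sum>w\<in>W. \<eta> w * ((norm (u w t))\<^sup>2 + (norm (u (s \<alpha> w) t))\<^sup>2 - 2 * Re (p \<alpha> w t)))"
        by (simp add: algebra_simps sum.distrib sum_subtractf sum_distrib_left)
      also have "\<dots> \<ge> 0"
      proof (intro sum_nonneg mult_nonneg_nonneg \<eta>0)
        fix w assume "w \<in> W"
        have "(norm (u w t))\<^sup>2 + (norm (u (s \<alpha> w) t))\<^sup>2 - 2 * Re (p \<alpha> w t) = (norm (u w t - u (s \<alpha> w) t))\<^sup>2"
          unfolding p_def cmod_power2 by (simp add: power2_eq_square algebra_simps)
        then show "0 \<le> (norm (u w t))\<^sup>2 + (norm (u (s \<alpha> w) t))\<^sup>2 - 2 * Re (p \<alpha> w t)" by simp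
      qed
      finally show ?thesis unfolding \<eta>_def by simp
    qed
    then have "0 \<le> (\<Sum>\<alpha>\<in>R. k \<alpha> * (\<Sum>w\<in>W. (1 / t - r t (b \<alpha> w)) * ((norm (u w t))\<^sup>2 - Re (p \<alpha> w t))))"
      by (intro sum_nonneg[of R] mult_nonneg_nonneg[OF k])
    also have "\<dots> = (\<Sum>w\<in>W. \<Sum>\<alpha>\<in>R. k \<alpha> * ((1 / t - r t (b \<alpha> w)) * ((norm (u w t))\<^sup>2 - Re (p \<alpha> w t))))"
      unfolding sum_distrib_left by (rule sum.swap)
    also have "\<dots> = 1 / t * (\<Sum>w\<in>W. \<Sum>\<alpha>\<in>R. k \<alpha> * ((norm (u w t))\<^sup>2 - Re (p \<alpha> w t))) -
      (\<Sum>w\<in>W. \<Sum>\<alpha>\<in>R. k \<alpha> * (r t (b \<alpha> w) * ((norm (u w t))\<^sup>2 - Re (p \<alpha> w t))))"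
      unfolding sum_distrib_left sum_subtractf[symmetric] by (intro sum.cong) (auto simp: algebra_simps)
    finally show ?thesis by simp
  qed
  have sum_rN: "(\<Sum>w\<in>W. \<Sum>\<alpha>\<in>R. k \<alpha> * (r t (b \<alpha> w) * ((norm (u w t))\<^sup>2 - Re (p \<alpha> w t)))) =
      g' t * N t - (\<Sum>w\<in>W. \<Sum>\<alpha>\<in>R. k \<alpha> * (r t (b \<alpha> w) * Re (p \<alpha> w t)))" for t
  proof -
    have "g' t * N t = (\<Sum>w\<in>W. (\<Sum>\<alpha>\<in>R. k \<alpha> * r t (b \<alpha> w)) * (norm (u w t))\<^sup>2)"
      unfolding N_def sum_distrib_left by (intro sum.cong) (auto simp: g'_r)
    also have "\<dots> = (\<Sum>w\<in>W. \<Sum>\<alpha>\<in>R. k \<alpha> * (r t (b \<alpha> w) * (norm (u w t))\<^sup>2))"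
      unfolding sum_distrib_right by (simp add: mult.assoc)
    finally show ?thesis
      by (simp add: sum_subtractf[symmetric] right_diff_distrib)
  qed

  \<comment> \<open>Bounds for the boundary term, the error and the weights\<close>
  have S_half: "\<bar>S t\<bar> \<le> N t / 2" for t
  proof -
    have "\<bar>S t\<bar> \<le> (\<Sum>w\<in>W. \<Sum>\<alpha>\<in>R. k \<alpha> * M * (1 / (2 * A)) * N t)"
      unfolding S_def abs_minus_cancel
    proof (intro order_trans[OF sum_abs] sum_mono)
      fix w \<alpha> assume w: "w \<in> W" and \<alpha>: "\<alpha> \<in> R"
      show "\<bar>k \<alpha> / c \<alpha> * \<psi> t (b \<alpha> w) * Im (p \<alpha> w t)\<bar> \<le> k \<alpha> * M * (1 / (2 * A)) * N t"
        unfolding abs_mult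
        using kc[OF \<alpha>] bd_\<psi>[of t "b \<alpha> w"] order_trans[OF abs_Im_le_cmod pN[OF \<alpha> w, of t]] k[OF \<alpha>] M A1
        by (intro mult_mono mult_nonneg_nonneg) (auto simp: abs_mult)
    qed
    also have "\<dots> = (K * M * card W) / A * (N t / 2)"
      by (simp only: sum_constant K[symmetric] sum_distrib_right[symmetric]) (simp add: mult_ac)
    also have "\<dots> \<le> 1 * (N t / 2)"
      using A1 N0[of t] A by (intro mult_right_mono) auto
    finally show ?thesis by simp
  qed
  \<comment> \<open>A second bound on \<open>S\<close>, for the place where it is multiplied by
    \<open>g'\<close>: its factor \<open>t\<close> cancels the one in
    \<open>g' t \<le> K / t\<close>. Using \<open>S_half\<close> there would give up part of the
    decay rate.\<close>
  have S_e: "\<bar>S t\<bar> \<le> card W * (M * (t * J' t * N t))" if "t > 0" for t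
  proof -
    have "\<bar>S t\<bar> \<le> (\<Sum>w\<in>W. \<Sum>\<alpha>\<in>R. k \<alpha> * M * (t * e t (b \<alpha> w)) * N t)"
      unfolding S_def abs_minus_cancel
    proof (intro order_trans[OF sum_abs] sum_mono)
      fix w \<alpha> assume w: "w \<in> W" and \<alpha>: "\<alpha> \<in> R"
      show "\<bar>k \<alpha> / c \<alpha> * \<psi> t (b \<alpha> w) * Im (p \<alpha> w t)\<bar> \<le> k \<alpha> * M * (t * e t (b \<alpha> w)) * N t"
        unfolding abs_mult
        using kc[OF \<alpha>] \<psi>_e[OF that, of "b \<alpha> w"] order_trans[OF abs_Im_le_cmod pN[OF \<alpha> w, of t]] k[OF \<alpha>] M that
        by (intro mult_mono mult_nonneg_nonneg) (auto simp: abs_mult e0)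
    qed
    also have "\<dots> = (\<Sum>w\<in>W. (\<Sum>\<alpha>\<in>R. k \<alpha> * e t (b \<alpha> w)) * (M * t * N t))"
      unfolding sum_distrib_right by (intro sum.cong) auto
    also have "\<dots> = (\<Sum>w\<in>W. J' t * (M * t * N t))" by (intro sum.cong) (auto simp: J'_e)
    finally show ?thesis by (simp add: algebra_simps)
  qed
  have err_e: "\<bar>err t\<bar> \<le> card W * (M * (1 + 2 * K) * (J' t * N t))" if "t > 0" for t
  proof -
    have "\<bar>err t\<bar> \<le> (\<Sum>w\<in>W. \<Sum>\<alpha>\<in>R. k \<alpha> * M * (e t (b \<alpha> w) * N t + e t (b \<alpha> w) * (2 * K * N t)))"
      unfolding err_def
    proof (intro order_trans[OF sum_abs] sum_mono)
      fix w \<alpha> assume w: "w \<in> W" and \<alpha>: "\<alpha> \<in> R"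
      have "\<bar>\<psi> t (b \<alpha> w) * Im (q \<alpha> w t) / t\<bar> = e t (b \<alpha> w) * \<bar>Im (q \<alpha> w t)\<bar>"
        using \<psi>_e[OF that, of "b \<alpha> w"] that by (simp add: abs_mult)
      also have "\<dots> \<le> e t (b \<alpha> w) * (2 * K * N t)"
        using order_trans[OF abs_Im_le_cmod qN[OF \<alpha> w, of t]] e0 by (intro mult_left_mono) auto
      finally have 1: "\<bar>\<psi> t (b \<alpha> w) * Im (q \<alpha> w t) / t\<bar> \<le> e t (b \<alpha> w) * (2 * K * N t)" .
      have 2: "\<bar>\<psi>' t (b \<alpha> w) * Im (p \<alpha> w t)\<bar> \<le> e t (b \<alpha> w) * N t"
        unfolding abs_mult using bd_\<psi>' e0 order_trans[OF abs_Im_le_cmod pN[OF \<alpha> w, of t]]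
        by (intro mult_mono) auto
      show "\<bar>k \<alpha> / c \<alpha> * (\<psi>' t (b \<alpha> w) * Im (p \<alpha> w t) + \<psi> t (b \<alpha> w) * Im (q \<alpha> w t) / t)\<bar>
        \<le> k \<alpha> * M * (e t (b \<alpha> w) * N t + e t (b \<alpha> w) * (2 * K * N t))"
        unfolding abs_mult using kc[OF \<alpha>] 1 2 k[OF \<alpha>] M
        by (intro mult_mono order_trans[OF abs_triangle_ineq]) (auto simp: abs_mult)
    qed
    also have "\<dots> = (\<Sum>w\<in>W. (\<Sum>\<alpha>\<in>R. k \<alpha> * e t (b \<alpha> w)) * (M * (1 + 2 * K) * N t))"
      unfolding sum_distrib_right by (intro sum.cong) (auto simp: algebra_simps)
    also have "\<dots> = (\<Sum>w\<in>W. J' t * (M * (1 + 2 * K) * N t))" by (intro sum.cong) (auto simp: J'_e)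
    finally show ?thesis by (simp add: algebra_simps)
  qed
  have g'0: "g' t \<ge> 0" and g'K: "g' t \<le> K / t" if "t > 0" for t
  proof -
    show "g' t \<ge> 0" unfolding g'_def using pos that
      by (intro sum_nonneg mult_nonneg_nonneg k divide_nonneg_pos) auto
    have "g' t \<le> (\<Sum>\<alpha>\<in>R. k \<alpha> * (1 / t))"
      unfolding g'_def using r_le[OF that] unfolding r_def by (intro sum_mono mult_left_mono k) auto
    then show "g' t \<le> K / t" unfolding K by (simp add: sum_divide_distrib)
  qed
  have J'0: "J' t \<ge> 0" for t
    unfolding J'_def by (intro sum_nonneg mult_nonneg_nonneg k e0)
  have dg: "(g has_real_derivative g' t) (at t)" for t
  proof -
    have "((\<lambda>t. ln (1 + (t * y / A)\<^sup>2)) has_real_derivative (2 * (t * y\<^sup>2 / (A\<^sup>2 + t\<^sup>2 * y\<^sup>2)))) (at t)" for y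
    proof -
      have "1 + (t * y / A)\<^sup>2 > 0" by (simp add: add_pos_nonneg)
      moreover have "1 + (t * y / A)\<^sup>2 = (A\<^sup>2 + t\<^sup>2 * y\<^sup>2) / A\<^sup>2"
        using A1 by (simp add: field_simps)
      ultimately show ?thesis
        using pos[of t y] A1
        by (auto intro!: derivative_eq_intros simp: power2_eq_square field_simps)
    qed
    then have "((\<lambda>t. \<Sum>\<alpha>\<in>R. k \<alpha> / 2 * ln (1 + (t * a \<alpha> / A)\<^sup>2)) has_real_derivative
       (\<Sum>\<alpha>\<in>R. k \<alpha> / 2 * (2 * (t * (a \<alpha>)\<^sup>2 / (A\<^sup>2 + t\<^sup>2 * (a \<alpha>)\<^sup>2))))) (at t)"
      by (intro DERIV_sum DERIV_cmult)
    then show ?thesis unfolding g_def g'_def by simp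
  qed
  have dJ: "(J has_real_derivative A * J' t) (at t)" for t
  proof -
    have "((\<lambda>t. arctan (t * \<bar>y\<bar> / A)) has_real_derivative (A * e t y)) (at t)" for y
    proof -
      have "1 + (t * \<bar>y\<bar> / A)\<^sup>2 = (A\<^sup>2 + t\<^sup>2 * y\<^sup>2) / A\<^sup>2"
        using A1 by (simp add: field_simps)
      then show ?thesis unfolding e_def
        using pos[of t y] A1
        by (auto intro!: derivative_eq_intros simp: power2_eq_square field_simps)
    qed
    then have "((\<lambda>t. \<Sum>\<alpha>\<in>R. k \<alpha> * arctan (t * \<bar>a \<alpha>\<bar> / A)) has_real_derivative
       (\<Sum>\<alpha>\<in>R. k \<alpha> * (A * e t (a \<alpha>)))) (at t)"
      by (intro DERIV_sum DERIV_cmult)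
    moreover have "(\<Sum>\<alpha>\<in>R. k \<alpha> * (A * e t (a \<alpha>))) = A * J' t"
      unfolding J'_def sum_distrib_left by (intro sum.cong) auto
    ultimately show ?thesis unfolding J_def by simp
  qed
  \<comment> \<open>The factor \<open>exp (g t)\<close> compensates the dissipation, and
    \<open>exp (- D / A * J t)\<close> absorbs all error terms.\<close>
  define \<Lambda> where "\<Lambda> = (\<lambda>t. exp (g t - D / A * J t) * (N t - S t))"
  \<comment> \<open>The system is singular at \<open>t = 0\<close>, so monotonicity comes from the
    derivative on the open interval together with continuity at the end points.\<close>
  have "\<Lambda> 1 \<le> \<Lambda> 0"
  proof (rule DERIV_nonpos_imp_decreasing_open[where f = \<Lambda>])
    fix t :: real assume t: "0 < t" "t < 1"
    let ?N' = "- (1 / t) * (\<Sum>w\<in>W. \<Sum>\<alpha>\<in>R. k \<alpha> * ((norm (u w t))\<^sup>2 - Re (p \<alpha> w t)))"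
    let ?S' = "(\<Sum>w\<in>W. \<Sum>\<alpha>\<in>R. k \<alpha> * (r t (b \<alpha> w) * Re (p \<alpha> w t))) - err t"
    have "(\<Lambda> has_real_derivative
       (exp (g t - D / A * J t) * (g' t - D / A * (A * J' t)) * (N t - S t) +
        (?N' - ?S') * exp (g t - D / A * J t))) (at t)"
      unfolding \<Lambda>_def
      by (intro DERIV_mult DERIV_diff dN dS t DERIV_fun_exp dg DERIV_cmult dJ)
    moreover have "exp (g t - D / A * J t) * (g' t - D / A * (A * J' t)) * (N t - S t) +
        (?N' - ?S') * exp (g t - D / A * J t) \<le> 0"
    proof -
      have "?N' - ?S' \<le> - (g' t * N t) + err t"
        using diss[OF t(1)] unfolding sum_rN by simp
      moreover have "g' t * \<bar>S t\<bar> \<le> card W * (M * K * (J' t * N t))"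
      proof -
        have "g' t * \<bar>S t\<bar> \<le> K / t * (card W * (M * (t * J' t * N t)))"
          using g'K[OF t(1)] S_e[OF t(1)] K0 t by (intro mult_mono) auto
        then show ?thesis using t by (simp add: field_simps)
      qed
      moreover have "- (g' t * S t) \<le> g' t * \<bar>S t\<bar>"
        using mult_left_mono[of "- S t" "\<bar>S t\<bar>" "g' t"] g'0[OF t(1)] by simp
      moreover have "err t \<le> card W * (M * (1 + 2 * K) * (J' t * N t))"
        using err_e[OF t(1)] by simp
      moreover have "D * J' t * (N t / 2) \<le> D * J' t * (N t - S t)"
        using S_half[of t] D0 J'0 by (intro mult_left_mono) auto
      \<comment> \<open>\<open>D\<close> is chosen for this identity: \<open>1 + 2 * K\<close> pays
        for \<open>err\<close>, the further \<open>K\<close> for the product of \<open>g'\<close>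
        and \<open>S\<close>, and the factor 2 for the passage from \<open>N - S\<close> to
        \<open>N / 2\<close>.\<close>
      moreover have "D * J' t * (N t / 2) = card W * (M * (1 + 2 * K) * (J' t * N t)) + card W * (M * K * (J' t * N t))"
        unfolding D by (simp add: algebra_simps)
      moreover have "D / A * (A * J' t) * (N t - S t) = D * J' t * (N t - S t)" using A1 by simp
      ultimately have "(g' t - D / A * (A * J' t)) * (N t - S t) + (?N' - ?S') \<le> 0"
        unfolding left_diff_distrib right_diff_distrib[of "g' t"] by linarith
      then have "exp (g t - D / A * J t) * ((g' t - D / A * (A * J' t)) * (N t - S t) + (?N' - ?S')) \<le> 0"
        by (intro mult_nonneg_nonpos) auto
      then show ?thesis by (simp only: distrib_left mult_ac)
    qed
    ultimately show "\<exists>y. (\<Lambda> has_real_derivative y) (at t) \<and> y \<le> 0" by blast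
  next
    have "continuous_on {0..1} g" "continuous_on {0..1} J"
      using DERIV_isCont[OF dg] DERIV_isCont[OF dJ] by (auto intro: continuous_at_imp_continuous_on)
    moreover have "continuous_on {0..1} N"
      unfolding N_def by (intro continuous_intros cont)
    moreover have "continuous_on {0..1} (\<lambda>t. \<psi> t y)" for y
      using DERIV_isCont[OF d\<psi>] by (auto intro: continuous_at_imp_continuous_on)
    then have "continuous_on {0..1} S"
      unfolding S_def p_def by (intro continuous_intros cont s)
    ultimately show "continuous_on {0..1} \<Lambda>"
      unfolding \<Lambda>_def by (intro continuous_intros)
  qed simp
  \<comment> \<open>At 0 the exponential weight is 1 and \<open>S\<close> vanishes together with
    \<open>\<psi>\<close>, which leaves the initial norms.\<close>
  moreover have "\<Lambda> 0 = card W"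
    unfolding \<Lambda>_def g_def J_def N_def S_def \<psi>_def by (simp add: init)
  moreover have "exp (g 1 - D / A * J 1) * (N 1 / 2) \<le> \<Lambda> 1"
    unfolding \<Lambda>_def using S_half[of 1] by (intro mult_left_mono) auto
  ultimately have 1: "exp (g 1 - D / A * J 1) * (N 1 / 2) \<le> card W" by simp
  have "J 1 \<le> (\<Sum>\<alpha>\<in>R. k \<alpha> * (pi / 2))"
    unfolding J_def by (intro sum_mono mult_left_mono k less_imp_le arctan_ubound)
  then have J1: "J 1 \<le> K * (pi / 2)" unfolding K by (simp add: sum_distrib_right sum_divide_distrib)
  have "(norm (u w0 1))\<^sup>2 \<le> N 1" by (rule uN[OF w0])
  also have "\<dots> = 2 * exp (D / A * J 1) * exp (- g 1) * (exp (g 1 - D / A * J 1) * (N 1 / 2))"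
    by (simp add: exp_diff exp_minus)
  also have "\<dots> \<le> 2 * exp (D / A * J 1) * exp (- g 1) * card W"
    by (intro mult_left_mono 1) auto
  also have "\<dots> \<le> 2 * exp (D * K * pi / (2 * A)) * exp (- g 1) * card W"
    using mult_left_mono[OF J1, of "D / A"] D0 A1 by (intro mult_right_mono mult_left_mono) (auto simp: field_simps)
  finally show ?thesis unfolding g_def by (simp add: mult_ac)
qed

section \<open>The Dunkl kernel on imaginary rays\<close>

lemma linear_root_reflect: "linear (root_reflect \<alpha>)"
  unfolding root_reflect_def by (intro linearI) (auto simp: inner_add_right algebra_simps)

lemma root_reflect_involution:
  assumes "\<alpha> \<bullet> \<alpha> = 2" shows "root_reflect \<alpha> (root_reflect \<alpha> x) = x"
  using assms by (simp add: root_reflect_def inner_diff_right algebra_simps)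

lemma root_reflect_adjoint: "\<beta> \<bullet> root_reflect \<alpha> x = root_reflect \<alpha> \<beta> \<bullet> x"
  by (simp add: root_reflect_def inner_diff_right inner_diff_left inner_commute)

lemma reflection_group_linear: "w \<in> reflection_group R \<Longrightarrow> linear w"
proof (induction rule: reflection_group.induct)
  case (refl w \<alpha>)
  from linear_compose[OF refl.IH linear_root_reflect] show ?case .
qed (rule linear_id)

lemma root_system_uminus:
  assumes "normalized_root_system R" "\<alpha> \<in> R" shows "- \<alpha> \<in> R"
  using assms unfolding normalized_root_system_def by blast

lemma root_system_reflect:
  assumes "normalized_root_system R" "\<alpha> \<in> R" "\<beta> \<in> R" shows "root_reflect \<alpha> \<beta> \<in> R"
  using assms unfolding normalized_root_system_def by blast

lemma reflection_group_root:
  assumes "normalized_root_system R" "w \<in> reflection_group R" "\<beta> \<in> R" shows "w \<beta> \<in> R"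
  using assms(2,3)
  by (induction arbitrary: \<beta> rule: reflection_group.induct) (auto intro: root_system_reflect[OF assms(1)])

text \<open>A group element is linear, hence determined by its restriction to the spanning set
  \<open>R\<close>, and this restriction is one of the finitely many maps from \<open>R\<close> to
  itself.\<close>

lemma finite_reflection_group:
  assumes R: "normalized_root_system (R :: 'a::euclidean_space set)"
  shows "finite (reflection_group R)"
proof (rule inj_on_finite)
  show "inj_on (\<lambda>w. restrict w R) (reflection_group R)"
  proof (rule inj_onI)
    fix v w assume vw: "v \<in> reflection_group R" "w \<in> reflection_group R" "restrict v R = restrict w R"
    have "v x = w x" for x
    proof (rule linear_eq_on_span[of v w R])
      show "x \<in> span R" using R by (simp add: normalized_root_system_def)
      show "v y = w y" if "y \<in> R" for y using fun_cong[OF vw(3), of y] that by simp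
    qed (use vw reflection_group_linear in auto)
    then show "v = w" by auto
  qed
  show "(\<lambda>w. restrict w R) ` reflection_group R \<subseteq> R \<rightarrow>\<^sub>E R"
    using reflection_group_root[OF R] by (auto simp: restrict_PiE_iff)
  show "finite (R \<rightarrow>\<^sub>E R)" using R by (auto simp: normalized_root_system_def intro: finite_PiE)
qed

lemma multiplicity_reflect:
  assumes "multiplicity_function R k" "\<alpha> \<in> R" "\<beta> \<in> R" shows "k (root_reflect \<alpha> \<beta>) = k \<beta>"
  using assms reflection_group.refl[OF reflection_group.id assms(2)]
  unfolding multiplicity_function_def by fastforce

lemma multiplicity_uminus:
  assumes "normalized_root_system R" "multiplicity_function R k" "\<alpha> \<in> R" shows "k (- \<alpha>) = k \<alpha>"
proof -
  have "\<alpha> \<bullet> \<alpha> = 2" using assms(1,3) unfolding normalized_root_system_def by blast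
  then have "root_reflect \<alpha> \<alpha> = - \<alpha>" unfolding root_reflect_def by (simp add: scaleR_2)
  then show ?thesis using multiplicity_reflect[OF assms(2,3,3)] by simp
qed

text \<open>Each generating reflection is self-adjoint and permutes \<open>R\<close> while
  preserving \<open>k\<close>, so reindexing the sum removes it. This gives the same decay rate at
  all points of an orbit.\<close>

lemma multiplicity_sum_invariant:
  fixes k :: "'a::euclidean_space \<Rightarrow> real" and h :: "real \<Rightarrow> real"
  assumes R: "normalized_root_system R" and k: "multiplicity_function R k" and w: "w \<in> reflection_group R"
  shows "(\<Sum>\<alpha>\<in>R. k \<alpha> * h (\<alpha> \<bullet> w x)) = (\<Sum>\<alpha>\<in>R. k \<alpha> * h (\<alpha> \<bullet> x))"
  using w
proof (induction rule: reflection_group.induct)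
  case (refl w \<beta>)
  have \<beta>: "\<beta> \<bullet> \<beta> = 2" using R refl.hyps unfolding normalized_root_system_def by blast
  have "(\<Sum>\<alpha>\<in>R. k \<alpha> * h (\<alpha> \<bullet> (root_reflect \<beta> \<circ> w) x)) = (\<Sum>\<alpha>\<in>R. k \<alpha> * h (\<alpha> \<bullet> w x))"
    by (rule sum.reindex_bij_witness[of _ "root_reflect \<beta>" "root_reflect \<beta>"])
      (auto simp: root_reflect_involution[OF \<beta>] root_system_reflect[OF R \<open>\<beta> \<in> R\<close>]
         multiplicity_reflect[OF k \<open>\<beta> \<in> R\<close>] root_reflect_adjoint)
  then show ?case using refl.IH by simp
qed simp

text \<open>\<open>R\<close> is the disjoint union of \<open>P\<close> and its negative. The lemma
  replaces the sum over \<open>P\<close> in the Dunkl operator by one over \<open>R\<close>, which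
  the reflections permute.\<close>

lemma sum_positive_system:
  fixes F :: "'a::euclidean_space \<Rightarrow> 'b::real_vector"
  assumes R: "normalized_root_system R" and P: "positive_system R P"
    and F: "\<And>\<alpha>. \<alpha> \<in> R \<Longrightarrow> F (- \<alpha>) = F \<alpha>"
  shows "(\<Sum>\<alpha>\<in>R. F \<alpha>) = 2 *\<^sub>R (\<Sum>\<alpha>\<in>P. F \<alpha>)"
proof -
  obtain v where v: "\<forall>\<alpha>\<in>R. \<alpha> \<bullet> v \<noteq> 0" and Pv: "P = {\<alpha>\<in>R. \<alpha> \<bullet> v > 0}"
    using P unfolding positive_system_def by auto
  have fin: "finite P" "finite (uminus ` P)" using R unfolding Pv normalized_root_system_def by simp_all
  have Req: "R = P \<union> uminus ` P"
  proof
    show "R \<subseteq> P \<union> uminus ` P"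
    proof
      fix \<alpha> assume \<alpha>: "\<alpha> \<in> R"
      show "\<alpha> \<in> P \<union> uminus ` P"
      proof (cases "\<alpha> \<bullet> v > 0")
        case False
        then have "- \<alpha> \<in> P" using v \<alpha> root_system_uminus[OF R \<alpha>] by (force simp: Pv)
        then have "- (- \<alpha>) \<in> uminus ` P" by (rule imageI)
        then show ?thesis by simp
      qed (use \<alpha> Pv in auto)
    qed
  qed (auto simp: Pv root_system_uminus[OF R])
  have "sum F R = sum F P + sum F (uminus ` P)"
    unfolding Req using fin by (rule sum.union_disjoint) (auto simp: Pv)
  also have "sum F (uminus ` P) = sum F P"
    by (subst sum.reindex) (auto simp: Pv F intro!: sum.cong)
  finally show ?thesis by (simp add: scaleR_2)
qed

text \<open>Joint holomorphy is composed with the inclusion of the second argument. Complex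
  linearity of \<open>D\<close> later links real and imaginary directions.\<close>

lemma dunkl_kernel_differentiable:
  assumes "is_dunkl_kernel P k E"
  obtains D where "(E l has_derivative D) (at z)" "\<And>v. D (mult_ii v) = \<i> * D v"
proof -
  have "entire_wrt (map_prod mult_ii mult_ii) (\<lambda>(l, z). E l z)"
    using assms unfolding is_dunkl_kernel_def by blast
  then obtain D where D: "((\<lambda>(l, z). E l z) has_derivative D) (at (l, z))"
    and J: "\<And>v. D (map_prod mult_ii mult_ii v) = \<i> * D v"
    unfolding entire_wrt_def by blast
  have "((\<lambda>z. (l, z)) has_derivative (\<lambda>v. (0, v))) (at z)"
    by (auto intro!: derivative_eq_intros)
  from has_derivative_compose[OF this D] have "(E l has_derivative (\<lambda>v. D (0, v))) (at z)"
    by simp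
  moreover have "D (0, mult_ii v) = \<i> * D (0, v)" for v
    using J[of "(0, v)"] by (simp add: mult_ii_def zero_prod_def)
  ultimately show thesis by (rule that)
qed

text \<open>The eigenvalue equation is taken at the point \<open>(0, t *\<^sub>R y)\<close> in the
  direction \<open>y\<close> itself. The coefficient \<open>\<alpha> \<bullet> y\<close> of each
  reflection term then cancels against the denominator
  \<open>\<i> * t * (\<alpha> \<bullet> y)\<close>, and of all the singularities only
  \<open>1 / t\<close> is left.\<close>

lemma dunkl_kernel_imaginary_ray:
  fixes k :: "'a::euclidean_space \<Rightarrow> real" and E :: "'a cplxn \<Rightarrow> 'a cplxn \<Rightarrow> complex"
  assumes R: "normalized_root_system R" and P: "positive_system R P" and k: "multiplicity_function R k"
    and E: "is_dunkl_kernel P (\<lambda>\<alpha>. complex_of_real (k \<alpha>)) E" and t: "t > 0"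
  shows "((\<lambda>t. E (of_real_vec l) (0, t *\<^sub>R y)) has_vector_derivative
     (\<i> * (y \<bullet> l) * E (of_real_vec l) (0, t *\<^sub>R y) - (1 / (2 * complex_of_real t)) *
        (\<Sum>\<alpha>\<in>R. k \<alpha> * (E (of_real_vec l) (0, t *\<^sub>R y) - E (of_real_vec l) (0, t *\<^sub>R root_reflect \<alpha> y))))) (at t)"
proof -
  define f where "f = E (of_real_vec l)"
  define z :: "'a cplxn" where "z = (0, t *\<^sub>R y)"
  obtain D where D: "(f has_derivative D) (at z)" and J: "\<And>v. D (mult_ii v) = \<i> * D v"
    using dunkl_kernel_differentiable[OF E] unfolding f_def by metis
  define F where "F = (\<lambda>\<alpha>. k \<alpha> * (f z - f (0, t *\<^sub>R root_reflect \<alpha> y)))"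
  have dd: "dir_deriv \<xi> f z = D (of_real_vec \<xi>)" for \<xi>
    unfolding dir_deriv_def using frechet_derivative_at[OF D] by simp
  \<comment> \<open>If \<open>\<alpha> \<bullet> y = 0\<close>, both sides are zero: the left one by
    its coefficient, the right one because the reflection fixes \<open>y\<close>.\<close>
  have quot: "k \<alpha> * complex_of_real (\<alpha> \<bullet> y) * difference_quotient \<alpha> f z = F \<alpha> / (\<i> * t)" for \<alpha>
  proof (cases "\<alpha> \<bullet> y = 0")
    case True
    then show ?thesis by (simp add: F_def z_def root_reflect_def)
  next
    case False
    have "creflect \<alpha> z = (0, t *\<^sub>R root_reflect \<alpha> y)"
      by (simp add: creflect_def z_def root_reflect_def algebra_simps)
    moreover have "cform (of_real_vec \<alpha>) z = \<i> * t * (\<alpha> \<bullet> y)"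
      by (simp add: cform_def of_real_vec_def z_def complex_eq_iff)
    ultimately show ?thesis
      using False t by (simp add: difference_quotient_def F_def field_simps)
  qed
  have "dunkl_operator P (\<lambda>\<alpha>. complex_of_real (k \<alpha>)) y f z = cform (of_real_vec y) (of_real_vec l) * f z"
    using E unfolding is_dunkl_kernel_def f_def by blast
  then have "D (of_real_vec y) + (\<Sum>\<alpha>\<in>P. F \<alpha> / (\<i> * t)) = (y \<bullet> l) * f z"
    unfolding dunkl_operator_def dd quot
    by (simp add: cform_def of_real_vec_def complex_eq_iff)
  then have "\<i> * D (of_real_vec y) = \<i> * (y \<bullet> l) * f z - (\<Sum>\<alpha>\<in>P. F \<alpha>) / t"
    using t by (simp add: sum_divide_distrib[symmetric] field_simps)
  also have "(\<Sum>\<alpha>\<in>P. F \<alpha>) / t = (1 / (2 * complex_of_real t)) * (\<Sum>\<alpha>\<in>R. F \<alpha>)"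
  proof -
    have "F (- \<alpha>) = F \<alpha>" if "\<alpha> \<in> R" for \<alpha>
      using multiplicity_uminus[OF R k that] by (simp add: F_def root_reflect_def)
    then show ?thesis using sum_positive_system[OF R P, of F] by (simp add: scaleR_conv_of_real)
  qed
  \<comment> \<open>\<open>J\<close> identifies \<open>\<i> * D (y, 0)\<close> with
    \<open>D (0, y)\<close>, the derivative along the imaginary ray.\<close>
  finally have eq: "D (0, y) = \<i> * (y \<bullet> l) * f z - (1 / (2 * complex_of_real t)) * (\<Sum>\<alpha>\<in>R. F \<alpha>)"
    using J[of "of_real_vec y"] by (simp add: mult_ii_def of_real_vec_def)
  have "((\<lambda>t. (0, t *\<^sub>R y)) has_derivative (\<lambda>s. (0, s *\<^sub>R y))) (at t)"
    by (auto intro!: derivative_eq_intros)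
  moreover have "(f has_derivative D) (at (0, t *\<^sub>R y))" using D unfolding z_def .
  ultimately have "((\<lambda>t. f (0, t *\<^sub>R y)) has_derivative (\<lambda>s. D (0, s *\<^sub>R y))) (at t)"
    by (rule has_derivative_compose)
  moreover have "D (0, s *\<^sub>R y) = s *\<^sub>R D (0, y)" for s
    using linear_scale[OF has_derivative_linear[OF D], of s "(0, y)"] by simp
  ultimately have "((\<lambda>t. f (0, t *\<^sub>R y)) has_vector_derivative D (0, y)) (at t)"
    unfolding has_vector_derivative_def by simp
  then show ?thesis unfolding eq F_def f_def z_def .
qed

text \<open>The values on the orbit of \<open>x\<close> satisfy the system of
  \<open>oscillatory_system_decay\<close> along rays. Regularity of \<open>l\<close> makes all
  frequencies \<open>\<alpha> \<bullet> l\<close> nonzero, and \<open>M\<close> dominates their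
  reciprocals; no constant depends on \<open>x\<close>.\<close>

lemma dunkl_kernel_imaginary_decay:
  fixes k :: "'a::euclidean_space \<Rightarrow> real" and E :: "'a cplxn \<Rightarrow> 'a cplxn \<Rightarrow> complex"
  assumes R: "normalized_root_system R" and P: "positive_system R P" and k: "multiplicity_function R k"
    and k0: "\<And>\<alpha>. \<alpha> \<in> R \<Longrightarrow> k \<alpha> \<ge> 0"
    and E: "is_dunkl_kernel P (\<lambda>\<alpha>. complex_of_real (k \<alpha>)) E" and l: "l \<in> regular_points R"
  shows "\<exists>A C. A > 0 \<and> C > 0 \<and> (\<forall>x. (norm (E (of_real_vec l) (0, x)))\<^sup>2 \<le>
     C * exp (- (\<Sum>\<alpha>\<in>R. k \<alpha> / 2 * ln (1 + ((\<alpha> \<bullet> x) / A)\<^sup>2))))"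
proof -
  define W where "W = reflection_group R"
  define M where "M = (\<Sum>\<alpha>\<in>R. 1 / \<bar>\<alpha> \<bullet> l\<bar>)"
  define K where "K = (\<Sum>\<alpha>\<in>R. k \<alpha>)"
  define A where "A = 1 + K * M * card W"
  define D where "D = 2 * M * (3 * K + 1) * card W"
  have finR: "finite R" using R by (simp add: normalized_root_system_def)
  have finW: "finite W" unfolding W_def by (rule finite_reflection_group[OF R])
  have idW: "id \<in> W" unfolding W_def by (rule reflection_group.id)
  have M0: "M \<ge> 0" unfolding M_def by (simp add: sum_nonneg)
  have K0: "K \<ge> 0" unfolding K_def by (simp add: k0 sum_nonneg)
  have c: "1 \<le> M * \<bar>\<alpha> \<bullet> l\<bar>" if "\<alpha> \<in> R" for \<alpha>
  proof -
    have "1 / \<bar>\<alpha> \<bullet> l\<bar> \<le> M" unfolding M_def using finR that by (intro member_le_sum) auto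
    moreover have "\<alpha> \<bullet> l \<noteq> 0" using l that unfolding regular_points_def by auto
    ultimately show ?thesis by (simp add: field_simps)
  qed
  have root2: "\<alpha> \<bullet> \<alpha> = 2" if "\<alpha> \<in> R" for \<alpha> using R that unfolding normalized_root_system_def by blast
  \<comment> \<open>The ray equation is available for positive \<open>t\<close> only; continuity
    down to \<open>t = 0\<close> comes from holomorphy.\<close>
  have contE: "continuous_on UNIV (E (of_real_vec l))"
    unfolding continuous_on_eq_continuous_within
    by (metis dunkl_kernel_differentiable[OF E] has_derivative_continuous)
  have "(norm (E (of_real_vec l) (0, x)))\<^sup>2 \<le> 2 * card W * exp (D * K * pi / (2 * A)) *
     exp (- (\<Sum>\<alpha>\<in>R. k \<alpha> / 2 * ln (1 + ((\<alpha> \<bullet> x) / A)\<^sup>2)))" for x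
  proof -
    \<comment> \<open>Only \<open>u id\<close> is wanted, but reflections lead from
      \<open>w x\<close> to other points of the orbit, so the system closes only over the whole
      group.\<close>
    define u where "u = (\<lambda>w t. E (of_real_vec l) (0, t *\<^sub>R w x))"
    have "(norm (u id 1))\<^sup>2 \<le> 2 * card W * exp (D * K * pi / (2 * A)) *
      exp (- (\<Sum>\<alpha>\<in>R. k \<alpha> / 2 * ln (1 + ((\<alpha> \<bullet> x) / A)\<^sup>2)))"
    proof (rule oscillatory_system_decay[where u = u and W = W and a = "\<lambda>\<alpha>. \<alpha> \<bullet> x" and s = "\<lambda>\<alpha> w. root_reflect \<alpha> \<circ> w" and c = "\<lambda>\<alpha>. \<alpha> \<bullet> l"
          and b = "\<lambda>\<alpha> w. \<alpha> \<bullet> w x" and \<theta> = "\<lambda>w. w x \<bullet> l"])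
      fix \<alpha> w assume \<alpha>: "\<alpha> \<in> R" and w: "w \<in> W"
      show "root_reflect \<alpha> \<circ> w \<in> W" using w \<alpha> unfolding W_def by (rule reflection_group.refl)
      show "root_reflect \<alpha> \<circ> (root_reflect \<alpha> \<circ> w) = w"
        by (auto simp: root_reflect_involution[OF root2[OF \<alpha>]])
      show "\<alpha> \<bullet> (root_reflect \<alpha> \<circ> w) x = - (\<alpha> \<bullet> w x)"
        using root2[OF \<alpha>] by (simp add: root_reflect_def inner_diff_right)
      show "w x \<bullet> l - (root_reflect \<alpha> \<circ> w) x \<bullet> l = (\<alpha> \<bullet> l) * (\<alpha> \<bullet> w x)"
        by (simp add: root_reflect_def inner_diff_left)
    next
      fix w t assume "w \<in> W" "0 < (t::real)" "t < 1"
      then show "(u w has_vector_derivative \<i> * (w x \<bullet> l) * u w t - (1 / (2 * complex_of_real t)) *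
         (\<Sum>\<alpha>\<in>R. k \<alpha> * (u w t - u (root_reflect \<alpha> \<circ> w) t))) (at t)"
        using dunkl_kernel_imaginary_ray[OF R P k E, of t l "w x"] unfolding u_def by simp
    next
      fix w show "continuous_on {0..1} (u w)"
        unfolding u_def by (intro continuous_on_compose2[OF contE] continuous_intros) auto
    next
      fix w show "norm (u w 0) = 1"
        using E unfolding u_def is_dunkl_kernel_def by (simp add: zero_prod_def of_real_vec_def)
    next
      fix h :: "real \<Rightarrow> real" and w assume "w \<in> W"
      then show "(\<Sum>\<alpha>\<in>R. k \<alpha> * h (\<alpha> \<bullet> w x)) = (\<Sum>\<alpha>\<in>R. k \<alpha> * h (\<alpha> \<bullet> x))"
        unfolding W_def by (rule multiplicity_sum_invariant[OF R k])
    qed (use finW finR k0 M0 c K_def A_def D_def idW in auto)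
    then show ?thesis by (simp add: u_def)
  qed
  moreover have "A > 0" using K0 M0 unfolding A_def by (simp add: add_pos_nonneg)
  moreover have "card W > 0" using finW idW by (auto simp: card_gt_0_iff)
  ultimately show ?thesis by (intro exI[of _ A] exI[of _ "2 * card W * exp (D * K * pi / (2 * A))"]) auto
qed

section \<open>Integrability of the decay bound\<close>

text \<open>For nonnegative \<open>s\<close>,
  \<open>(1 + s)\<^sup>2 \<le> 2 * (1 + s\<^sup>2)\<close> gives the majorant \<open>H\<close>,
  whose antiderivative \<open>F\<close> tends to 0 at infinity because
  \<open>2 * \<kappa> > 1\<close>. The other half line is reduced to this one by
  \<open>uminus\<close>.\<close>

lemma nn_integral_inverse_quadratic_power_finite:
  fixes \<kappa> :: real
  assumes \<kappa>: "\<kappa> > 1 / 2"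
  shows "(\<integral>\<^sup>+s. ennreal (exp (- (\<kappa> * ln (1 + s\<^sup>2)))) \<partial>lborel) < \<infinity>"
proof -
  define H where "H = (\<lambda>s::real. 2 powr \<kappa> * (1 + s) powr (- (2 * \<kappa>)))"
  define F where "F = (\<lambda>s::real. 2 powr \<kappa> * ((1 + s) powr (1 - 2 * \<kappa>) / (1 - 2 * \<kappa>)))"
  have H_bound: "exp (- (\<kappa> * ln (1 + s\<^sup>2))) \<le> H s" if "s \<ge> 0" for s
  proof -
    have "(1 + s)\<^sup>2 \<le> 2 * (1 + s\<^sup>2)"
      using zero_le_power2[of "1 - s"] by (simp add: power2_eq_square algebra_simps)
    moreover have "1 + s\<^sup>2 > 0" by (simp add: add_pos_nonneg)
    ultimately have "ln ((1 + s)\<^sup>2) \<le> ln 2 + ln (1 + s\<^sup>2)"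
      using that ln_mult_pos[of 2 "1 + s\<^sup>2"] ln_le_cancel_iff[of "(1 + s)\<^sup>2" "2 * (1 + s\<^sup>2)"] by simp
    then have "2 * ln (1 + s) \<le> ln 2 + ln (1 + s\<^sup>2)"
      using that by (simp add: ln_realpow)
    then have "\<kappa> * (2 * ln (1 + s)) \<le> \<kappa> * (ln 2 + ln (1 + s\<^sup>2))"
      using \<kappa> by (intro mult_left_mono) auto
    then show ?thesis
      using that unfolding H_def powr_def by (simp add: exp_add[symmetric] algebra_simps)
  qed
  have "(\<integral>\<^sup>+s. ennreal (H s) * indicator {0..} s \<partial>lborel) = 0 - F 0"
  proof (rule nn_integral_FTC_atLeast)
    show "(F has_real_derivative H s) (at s)" if "0 \<le> s" for s
      unfolding F_def H_def using that \<kappa> by (auto intro!: derivative_eq_intros)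
    show "(F \<longlongrightarrow> 0) at_top"
    proof -
      have "((\<lambda>s::real. (1 + s) powr (1 - 2 * \<kappa>)) \<longlongrightarrow> 0) at_top"
        using \<kappa> by (intro tendsto_neg_powr filterlim_tendsto_add_at_top[OF tendsto_const] filterlim_ident) auto
      then have "(F \<longlongrightarrow> 2 powr \<kappa> * (0 / (1 - 2 * \<kappa>))) at_top"
        unfolding F_def using \<kappa> by (intro tendsto_intros) auto
      then show ?thesis by simp
    qed
  qed (auto simp: H_def)
  then have fin: "(\<integral>\<^sup>+s. ennreal (H s) * indicator {0..} s \<partial>lborel) < \<infinity>" by simp
  have "(\<integral>\<^sup>+s. ennreal (H (- s)) * indicator {0..} (- s) \<partial>lborel) =
      (\<integral>\<^sup>+s. ennreal (H s) * indicator {0..} s \<partial>distr lborel borel uminus)"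
    unfolding H_def by (subst nn_integral_distr) auto
  also have "\<dots> = (\<integral>\<^sup>+s. ennreal (H s) * indicator {0..} s \<partial>lborel)"
    by (simp add: lborel_distr_uminus)
  finally have neg: "(\<integral>\<^sup>+s. ennreal (H (- s)) * indicator {0..} (- s) \<partial>lborel) < \<infinity>"
    using fin by simp
  have "(\<integral>\<^sup>+s. ennreal (exp (- (\<kappa> * ln (1 + s\<^sup>2)))) \<partial>lborel) \<le>
     (\<integral>\<^sup>+s. ennreal (H s) * indicator {0..} s + ennreal (H (- s)) * indicator {0..} (- s) \<partial>lborel)"
  proof (rule nn_integral_mono)
    fix s :: real
    show "ennreal (exp (- (\<kappa> * ln (1 + s\<^sup>2)))) \<le>
       ennreal (H s) * indicator {0..} s + ennreal (H (- s)) * indicator {0..} (- s)"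
      using H_bound[of s] H_bound[of "- s"]
      by (cases "s > 0"; cases "s = 0") (auto simp: ennreal_leI intro!: add_increasing)
  qed
  also have "\<dots> = (\<integral>\<^sup>+s. ennreal (H s) * indicator {0..} s \<partial>lborel) +
      (\<integral>\<^sup>+s. ennreal (H (- s)) * indicator {0..} (- s) \<partial>lborel)"
    unfolding H_def by (rule nn_integral_add) auto
  also have "\<dots> < \<infinity>" using fin neg by simp
  finally show ?thesis .
qed

lemma nn_integral_lborel_translate:
  fixes c :: "'a::euclidean_space"
  assumes [measurable]: "f \<in> borel_measurable borel"
  shows "(\<integral>\<^sup>+x. f (c + x) \<partial>lborel) = (\<integral>\<^sup>+x. f x \<partial>lborel)"
proof -
  have "(\<integral>\<^sup>+x. f x \<partial>lborel) = (\<integral>\<^sup>+x. f x \<partial>distr lborel borel ((+) c))"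
    by (simp add: lborel_distr_plus)
  also have "\<dots> = (\<integral>\<^sup>+x. f (c + x) \<partial>lborel)" by (subst nn_integral_distr) auto
  finally show ?thesis by simp
qed

text \<open>This replaces the linear change of variables, which the library only has on \<open>real ^ 'n\<close>: one
  averages \<open>g (T x + z)\<close> over the unit ball in \<open>z\<close> and applies Tonelli.\<close>

lemma nn_integral_compose_linear_finite:
  fixes T :: "'a::euclidean_space \<Rightarrow> 'a" and g :: "'a \<Rightarrow> ennreal"
  assumes T: "linear T" "inj T" and g[measurable]: "g \<in> borel_measurable borel"
    and C: "C < \<infinity>" "\<And>y z. norm z < 1 \<Longrightarrow> g y \<le> C * g (y + z)"
    and fin: "(\<integral>\<^sup>+y. g y \<partial>lborel) < \<infinity>"
  shows "(\<integral>\<^sup>+x. g (T x) \<partial>lborel) < \<infinity>"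
proof -
  have [measurable]: "T \<in> borel_measurable borel"
    using linear_continuous_on[OF linear_conv_bounded_linear[THEN iffD1, OF T(1)]]
    by (rule borel_measurable_continuous_onI)
  define i :: "'a \<Rightarrow> ennreal" where "i = indicator (ball 0 1)"
  have [measurable]: "i \<in> borel_measurable borel" unfolding i_def by (intro borel_measurable_indicator borel_open open_ball)
  define v where "v = (\<integral>\<^sup>+z. i z \<partial>lborel)"
  define V where "V = (\<integral>\<^sup>+x. i (T x) \<partial>lborel)"
  have v: "v = ennreal (unit_ball_vol (DIM('a)))"
    unfolding v_def i_def by (simp add: emeasure_ball)
  \<comment> \<open>\<open>T\<close> is bounded below, so the preimage of the unit ball lies in a
    ball of radius \<open>1 / B\<close>.\<close>
  have V: "V < \<infinity>"
  proof -
    obtain B where B: "B > 0" "\<And>x. B * norm x \<le> norm (T x)"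
      using linear_inj_bounded_below_pos[OF T] by auto
    have "V \<le> (\<integral>\<^sup>+x. indicator (ball (0::'a) (1 / B)) x \<partial>lborel)"
      unfolding V_def i_def
    proof (intro nn_integral_mono)
      fix x :: 'a
      have "norm x < 1 / B" if "norm (T x) < 1"
        using B(1) le_less_trans[OF B(2)[of x] that] by (simp add: field_simps)
      then show "indicator (ball 0 1) (T x) \<le> (indicator (ball 0 (1 / B)) x :: ennreal)"
        by (auto simp: indicator_def)
    qed
    also have "\<dots> < \<infinity>" using B(1) by (simp add: emeasure_ball)
    finally show ?thesis .
  qed
  \<comment> \<open>By surjectivity the shift by \<open>y\<close> is the image of a shift by some
    \<open>x0\<close>, and translation invariance makes the integral independent of
    \<open>y\<close>.\<close>
  have inner: "(\<integral>\<^sup>+x. i (y - T x) \<partial>lborel) = V" for y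
  proof -
    obtain x0 where x0: "y = T x0"
      using linear_injective_imp_surjective[OF T] by (auto simp: surj_def)
    have "(\<integral>\<^sup>+x. i (y - T x) \<partial>lborel) = (\<integral>\<^sup>+x. i (T (- x0 + x)) \<partial>lborel)"
    proof (intro nn_integral_cong)
      fix x
      have "norm (y - T x) = norm (T (- x0 + x))"
        unfolding x0 using linear_diff[OF T(1), of x x0] by (simp add: norm_minus_commute)
      then show "i (y - T x) = i (T (- x0 + x))" unfolding i_def by (simp add: indicator_def)
    qed
    also have "\<dots> = V" unfolding V_def by (rule nn_integral_lborel_translate[where f = "\<lambda>x. i (T x)"]) simp
    finally show ?thesis .
  qed
  have "v * (\<integral>\<^sup>+x. g (T x) \<partial>lborel) = (\<integral>\<^sup>+x. \<integral>\<^sup>+z. i z * g (T x) \<partial>lborel \<partial>lborel)"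
    unfolding v_def by (simp add: nn_integral_cmult nn_integral_multc)
  also have "\<dots> \<le> (\<integral>\<^sup>+x. \<integral>\<^sup>+z. C * (i z * g (T x + z)) \<partial>lborel \<partial>lborel)"
    unfolding i_def using C(2) by (intro nn_integral_mono) (auto simp: indicator_def)
  also have "\<dots> = C * (\<integral>\<^sup>+x. \<integral>\<^sup>+z. i z * g (T x + z) \<partial>lborel \<partial>lborel)"
    by (simp add: nn_integral_cmult)
  also have "(\<integral>\<^sup>+x. \<integral>\<^sup>+z. i z * g (T x + z) \<partial>lborel \<partial>lborel) = (\<integral>\<^sup>+x. \<integral>\<^sup>+y. i (y - T x) * g y \<partial>lborel \<partial>lborel)"
  proof (rule nn_integral_cong)
    fix x :: 'a
    show "(\<integral>\<^sup>+z. i z * g (T x + z) \<partial>lborel) = (\<integral>\<^sup>+y. i (y - T x) * g y \<partial>lborel)"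
      using nn_integral_lborel_translate[of "\<lambda>y. i (y - T x) * g y" "T x"] by simp
  qed
  also have "\<dots> = (\<integral>\<^sup>+y. \<integral>\<^sup>+x. i (y - T x) * g y \<partial>lborel \<partial>lborel)"
    by (rule lborel_pair.Fubini') simp
  also have "\<dots> = (\<integral>\<^sup>+y. V * g y \<partial>lborel)"
    by (simp add: nn_integral_multc inner)
  also have "\<dots> = V * (\<integral>\<^sup>+y. g y \<partial>lborel)" by (simp add: nn_integral_cmult)
  also have "C * (V * (\<integral>\<^sup>+y. g y \<partial>lborel)) < \<infinity>"
    using C(1) V fin by (simp add: ennreal_mult_less_top)
  finally have "v * (\<integral>\<^sup>+x. g (T x) \<partial>lborel) < \<infinity>" .
  moreover have "v \<noteq> 0" unfolding v using unit_ball_vol_pos[of "real DIM('a)"] by (simp add: ennreal_eq_0_iff not_le del: unit_ball_vol_pos)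
  ultimately show ?thesis by (auto simp: ennreal_mult_less_top)
qed

text \<open>A basis \<open>B\<close> is chosen among the roots. The roots in \<open>B\<close> and
  their negatives contribute equal terms, so the exponent \<open>k / 2\<close> doubles to
  \<open>k\<close>, while the other roots only help. In coordinates along \<open>B\<close> the bound
  is a product of one-dimensional functions, each integrable because its exponent exceeds
  1/2.\<close>

lemma root_system_decay_integrable:
  fixes k :: "'a::euclidean_space \<Rightarrow> real"
  assumes fin: "finite R" and span: "span R = UNIV"
    and neg: "\<And>\<alpha>. \<alpha> \<in> R \<Longrightarrow> - \<alpha> \<in> R" and even: "\<And>\<alpha>. \<alpha> \<in> R \<Longrightarrow> k (- \<alpha>) = k \<alpha>"
    and k: "\<And>\<alpha>. \<alpha> \<in> R \<Longrightarrow> k \<alpha> > 1 / 2" and A: "A > 0"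
  shows "(\<integral>\<^sup>+x. ennreal (exp (- (\<Sum>\<alpha>\<in>R. k \<alpha> / 2 * ln (1 + ((\<alpha> \<bullet> x) / A)\<^sup>2)))) \<partial>lborel) < \<infinity>"
proof -
  obtain B where B: "B \<subseteq> R" "independent B" "R \<subseteq> span B"
    by (rule maximal_independent_subset)
  have spanB: "span B = UNIV"
    using span_mono[OF B(3)] span by (auto simp: span_span)
  have finB: "finite B" using fin B(1) by (rule finite_subset[rotated])
  have "card B = card (Basis :: 'a set)"
    using dim_eq_card_independent[OF B(2)] dim_span[of B] by (simp add: spanB)
  then obtain \<beta> where \<beta>: "bij_betw \<beta> (Basis :: 'a set) B"
    using finite_same_card_bij[of "Basis :: 'a set" B] finB by auto
  \<comment> \<open>Independence excludes opposite pairs, so \<open>B\<close> and its negative are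
    counted separately in the sum over \<open>R\<close>.\<close>
  have disj: "B \<inter> uminus ` B = {}"
  proof (rule ccontr)
    assume "B \<inter> uminus ` B \<noteq> {}"
    then obtain b where b: "b \<in> B" "- b \<in> B" by auto
    then have "b \<noteq> - b" using B(2) dependent_zero[of B] by (auto simp: eq_neg_iff_add_eq_0 simp flip: scaleR_2)
    then have "b \<in> span (B - {b})" using b span_neg[OF span_base, of "- b" "B - {b}"] by simp
    then show False using B(2) b(1) unfolding dependent_def by auto
  qed
  have lnpos: "ln (1 + s\<^sup>2) \<ge> 0" for s :: real by simp
  define \<kappa> where "\<kappa> = (\<lambda>b. k (\<beta> b))"
  have \<kappa>: "\<kappa> b > 1 / 2" if "b \<in> Basis" for b
    unfolding \<kappa>_def using bij_betwE[OF \<beta>] that B(1) k by auto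
  define T where "T = (\<lambda>x. \<Sum>b\<in>Basis. ((\<beta> b \<bullet> x) / A) *\<^sub>R b)"
  define g :: "'a \<Rightarrow> real" where "g = (\<lambda>y. exp (- (\<Sum>b\<in>Basis. \<kappa> b * ln (1 + (y \<bullet> b)\<^sup>2))))"
  have T_inner: "T x \<bullet> b = (\<beta> b \<bullet> x) / A" if "b \<in> Basis" for x b
    unfolding T_def using that by simp
  have linT: "linear T"
    unfolding T_def by (intro linearI)
      (auto simp: inner_add_right add_divide_distrib scaleR_add_left sum.distrib scaleR_sum_right)
  have injT: "inj T"
  proof (subst linear_injective_0[OF linT], intro allI impI)
    fix x assume "T x = 0"
    then have "\<beta> b \<bullet> x = 0" if "b \<in> Basis" for b using T_inner[OF that, of x] A by simp
    then have "\<forall>b\<in>B. b \<bullet> x = 0" using \<beta> unfolding bij_betw_def by auto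
    moreover have "x \<in> span B" by (simp add: spanB)
    ultimately have "x \<bullet> x = 0"
      using orthogonal_to_span[of x B x] by (simp add: orthogonal_def inner_commute)
    then show "x = 0" by simp
  qed
  have bound: "exp (- (\<Sum>\<alpha>\<in>R. k \<alpha> / 2 * ln (1 + ((\<alpha> \<bullet> x) / A)\<^sup>2))) \<le> g (T x)" for x
  proof -
    let ?f = "\<lambda>\<alpha>. k \<alpha> / 2 * ln (1 + ((\<alpha> \<bullet> x) / A)\<^sup>2)"
    have "(\<Sum>b\<in>Basis. \<kappa> b * ln (1 + (T x \<bullet> b)\<^sup>2)) = (\<Sum>b\<in>Basis. 2 * ?f (\<beta> b))"
      by (intro sum.cong) (auto simp: \<kappa>_def T_inner)
    also have "\<dots> = (\<Sum>\<alpha>\<in>B. 2 * ?f \<alpha>)" by (rule sum.reindex_bij_betw[OF \<beta>])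
    also have "\<dots> = sum ?f B + sum ?f (uminus ` B)"
    proof -
      have "sum ?f (uminus ` B) = sum ?f B"
        using B(1) even by (subst sum.reindex) (auto intro!: sum.cong)
      then show ?thesis by (simp only: mult_2 sum.distrib)
    qed
    also have "sum ?f B + sum ?f (uminus ` B) = sum ?f (B \<union> uminus ` B)"
      using finB disj by (intro sum.union_disjoint[symmetric]) auto
    also have "\<dots> \<le> sum ?f R"
    proof (rule sum_mono2)
      show "?f \<alpha> \<ge> 0" if "\<alpha> \<in> R - (B \<union> uminus ` B)" for \<alpha>
        using k[of \<alpha>] that by (intro mult_nonneg_nonneg lnpos) auto
    qed (use fin B(1) neg in auto)
    finally show ?thesis unfolding g_def by simp
  qed
  \<comment> \<open>A shift by less than 1 multiplies each \<open>1 + s\<^sup>2\<close> by at most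
    3, since \<open>1 + (s + r)\<^sup>2 \<le> 1 + 2 * s\<^sup>2 + 2 * r\<^sup>2\<close> and
    \<open>r\<^sup>2 \<le> 1\<close>.\<close>
  define C where "C = exp (\<Sum>b\<in>Basis. \<kappa> b * ln 3)"
  have shift: "g y \<le> C * g (y + z)" if z: "norm z < 1" for y z :: 'a
  proof -
    have "\<kappa> b * ln (1 + ((y + z) \<bullet> b)\<^sup>2) \<le> \<kappa> b * ln 3 + \<kappa> b * ln (1 + (y \<bullet> b)\<^sup>2)" if b: "b \<in> Basis" for b
    proof -
      define s r where "s = y \<bullet> b" and "r = z \<bullet> b"
      have "\<bar>r\<bar> \<le> 1" using Basis_le_norm[OF b, of z] z unfolding r_def by simp
      then have "r\<^sup>2 \<le> 1" by (simp add: abs_square_le_1)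
      moreover have "(s + r)\<^sup>2 \<le> 2 * s\<^sup>2 + 2 * r\<^sup>2"
        using zero_le_power2[of "s - r"] by (simp add: power2_eq_square algebra_simps)
      ultimately have "1 + (s + r)\<^sup>2 \<le> 3 * (1 + s\<^sup>2)" using zero_le_power2[of s] unfolding distrib_left by linarith
      moreover have "1 + (s + r)\<^sup>2 > 0" "1 + s\<^sup>2 > 0" by (simp_all add: add_pos_nonneg)
      ultimately have "ln (1 + (s + r)\<^sup>2) \<le> ln 3 + ln (1 + s\<^sup>2)"
        using ln_mult_pos[of 3 "1 + s\<^sup>2"] ln_le_cancel_iff[of "1 + (s + r)\<^sup>2" "3 * (1 + s\<^sup>2)"] by simp
      then show ?thesis
        using \<kappa>[OF b] unfolding s_def r_def inner_add_left distrib_left[symmetric] by (intro mult_left_mono) auto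
    qed
    then have "(\<Sum>b\<in>Basis. \<kappa> b * ln (1 + ((y + z) \<bullet> b)\<^sup>2)) \<le>
        (\<Sum>b\<in>Basis. \<kappa> b * ln 3) + (\<Sum>b\<in>Basis. \<kappa> b * ln (1 + (y \<bullet> b)\<^sup>2))"
      unfolding sum.distrib[symmetric] by (rule sum_mono)
    then show ?thesis unfolding g_def C_def by (simp add: exp_add[symmetric])
  qed
  have g_prod: "ennreal (g y) = (\<Prod>b\<in>Basis. ennreal (exp (- (\<kappa> b * ln (1 + (y \<bullet> b)\<^sup>2)))))" for y
    unfolding g_def by (subst prod_ennreal) (auto simp: exp_sum sum_negf[symmetric])
  have "(\<integral>\<^sup>+y. ennreal (g y) \<partial>lborel) < \<infinity>"
    unfolding g_prod
    by (subst nn_integral_lborel_prod)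
      (auto simp: less_top[symmetric] ennreal_prod_eq_top
        dest!: \<kappa>[THEN nn_integral_inverse_quadratic_power_finite])
  then have "(\<integral>\<^sup>+x. ennreal (g (T x)) \<partial>lborel) < \<infinity>"
  proof (rule nn_integral_compose_linear_finite[OF linT injT, rotated 3])
    show "ennreal C < \<infinity>" by simp
    show "(\<lambda>y. ennreal (g y)) \<in> borel_measurable borel" unfolding g_def by measurable
    show "ennreal (g y) \<le> ennreal C * ennreal (g (y + z))" if "norm z < 1" for y z
      using shift[OF that, of y] by (simp add: ennreal_mult[symmetric] C_def g_def ennreal_leI)
  qed
  then show ?thesis
    by (rule order.strict_trans1[rotated]) (intro nn_integral_mono ennreal_leI bound)
qed

section \<open>Measures with square integrable Fourier transform\<close>

lemma integral_lborel_prod: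
  fixes f :: "'a::euclidean_space \<Rightarrow> real \<Rightarrow> complex"
  assumes f: "\<And>b. b \<in> Basis \<Longrightarrow> integrable lborel (f b)"
  shows "integrable lborel (\<lambda>x. \<Prod>b\<in>Basis. f b (x \<bullet> b))"
    and "(\<integral>x. (\<Prod>b\<in>Basis. f b (x \<bullet> b)) \<partial>lborel) = (\<Prod>b\<in>Basis. integral\<^sup>L lborel (f b))"
proof -
  interpret product_sigma_finite "\<lambda>_::'a. lborel :: real measure"
    by standard
  have [measurable]: "f b \<in> borel_measurable borel" if "b \<in> Basis" for b
    using borel_measurable_integrable[OF f[OF that]] by simp
  have m: "(\<lambda>x. \<Prod>b\<in>Basis. f b (x \<bullet> b)) \<in> borel_measurable borel"
    by (intro borel_measurable_prod) measurable
  have eq: "(\<lambda>g. \<Prod>b\<in>Basis. f b ((\<Sum>b\<in>Basis. g b *\<^sub>R b) \<bullet> b)) = (\<lambda>g. \<Prod>b\<in>Basis. f b (g b))"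
    by (intro ext prod.cong) auto
  have D: "(\<lambda>g. \<Sum>b\<in>Basis. g b *\<^sub>R b) \<in> measurable (\<Pi>\<^sub>M b\<in>(Basis::'a set). (lborel :: real measure)) borel"
    by measurable
  show "integrable lborel (\<lambda>x. \<Prod>b\<in>Basis. f b (x \<bullet> b))"
    by (subst lborel_eq, subst integrable_distr_eq[OF D m], subst eq)
      (rule product_integrable_prod[OF finite_Basis f])
  show "(\<integral>x. (\<Prod>b\<in>Basis. f b (x \<bullet> b)) \<partial>lborel) = (\<Prod>b\<in>Basis. integral\<^sup>L lborel (f b))"
    by (subst lborel_eq, subst integral_distr[OF D m], subst eq)
      (rule product_integral_prod[OF finite_Basis f])
qed

definition gauss_density :: "'a::euclidean_space \<Rightarrow> real" where
  "gauss_density z = (\<Prod>b\<in>Basis. std_normal_density (z \<bullet> b))"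

lemma gauss_density_nonneg: "0 \<le> gauss_density z"
  unfolding gauss_density_def by (intro prod_nonneg) auto

lemma gauss_density_le_1: "gauss_density z \<le> 1"
  unfolding gauss_density_def
proof (intro prod_le_1 conjI)
  fix b :: 'a
  have "1 / sqrt (2 * pi) \<le> 1" using pi_gt3 by simp
  moreover have "exp (- (z \<bullet> b)\<^sup>2 / 2) \<le> 1" by simp
  ultimately show "std_normal_density (z \<bullet> b) \<le> 1"
    unfolding std_normal_density_def by (intro mult_le_one) auto
qed auto

lemma gauss_density_measurable [measurable]: "gauss_density \<in> borel_measurable borel"
  unfolding gauss_density_def by measurable

text \<open>Density and exponential both factor over the coordinates, which leaves the
  characteristic function of the standard normal distribution in each of them.\<close>

lemma gauss_density_fourier:
  fixes v :: "'a::euclidean_space"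
  shows "integrable lborel (\<lambda>z. gauss_density z * exp (\<i> * (z \<bullet> v)))"
    and "(\<integral>z. gauss_density z * exp (\<i> * (z \<bullet> v)) \<partial>lborel) = exp (- (norm v)\<^sup>2 / 2)"
proof -
  define f where "f = (\<lambda>b s. std_normal_density s *\<^sub>R iexp ((v \<bullet> b) * s))"
  have f: "integrable lborel (f b)" for b
    unfolding f_def
  proof (rule Bochner_Integration.integrable_bound)
    show "integrable lborel std_normal_density" using integrable_std_normal_moment[of 0] by simp
  qed auto
  have eq: "gauss_density z * exp (\<i> * (z \<bullet> v)) = (\<Prod>b\<in>Basis. f b (z \<bullet> b))" for z
  proof -
    have "exp (\<i> * (z \<bullet> v)) = exp (\<Sum>b\<in>Basis. \<i> * ((v \<bullet> b) * (z \<bullet> b)))"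
      by (simp add: euclidean_inner[of z v] sum_distrib_left mult_ac)
    also have "\<dots> = (\<Prod>b\<in>Basis. iexp ((v \<bullet> b) * (z \<bullet> b)))" by (simp add: exp_sum)
    finally show ?thesis
      unfolding f_def gauss_density_def by (simp add: scaleR_conv_of_real prod.distrib)
  qed
  have int: "integral\<^sup>L lborel (f b) = exp (- (v \<bullet> b)\<^sup>2 / 2)" for b
  proof -
    have "integral\<^sup>L lborel (f b) = char std_normal_distribution (v \<bullet> b)"
      unfolding char_def f_def by (subst integral_density) auto
    then show ?thesis by (simp add: char_std_normal_distribution)
  qed
  show "integrable lborel (\<lambda>z. gauss_density z * exp (\<i> * (z \<bullet> v)))"
    unfolding eq by (rule integral_lborel_prod(1)) (rule f)
  have "(\<integral>z. gauss_density z * exp (\<i> * (z \<bullet> v)) \<partial>lborel) = (\<Prod>b\<in>(Basis::'a set). complex_of_real (exp (- (v \<bullet> b)\<^sup>2 / 2)))"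
    unfolding eq by (subst integral_lborel_prod(2)[OF f]) (simp add: int)
  also have "\<dots> = complex_of_real (exp (- (norm v)\<^sup>2 / 2))"
    unfolding power2_norm_eq_inner euclidean_inner[of v v]
    by (simp add: exp_sum[symmetric] sum_negf[symmetric] sum_divide_distrib power2_eq_square flip: of_real_prod)
  finally show "(\<integral>z. gauss_density z * exp (\<i> * (z \<bullet> v)) \<partial>lborel) = exp (- (norm v)\<^sup>2 / 2)"
    by simp
qed

lemma gauss_density_integrable: "integrable lborel (gauss_density :: 'a::euclidean_space \<Rightarrow> real)"
proof -
  have "integrable lborel (\<lambda>z::'a. complex_of_real (gauss_density z))"
    using gauss_density_fourier(1)[of 0] by simp
  then show ?thesis by (simp add: complex_of_real_integrable_eq)
qed

lemma nn_integral_lborel_scale: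
  fixes f :: "'a::euclidean_space \<Rightarrow> ennreal"
  assumes [measurable]: "f \<in> borel_measurable borel" and c: "c > 0"
  shows "(\<integral>\<^sup>+z. f (z /\<^sub>R c) \<partial>lborel) = ennreal (c ^ DIM('a)) * (\<integral>\<^sup>+y. f y \<partial>lborel)"
proof -
  have "(\<integral>\<^sup>+z. f (z /\<^sub>R c) \<partial>lborel) =
     (\<integral>\<^sup>+z. f (z /\<^sub>R c) \<partial>density (distr lborel borel (\<lambda>x::'a. 0 + c *\<^sub>R x)) (\<lambda>_. \<bar>c\<bar>^DIM('a)))"
    using c by (subst lborel_affine[of c 0]) auto
  also have "\<dots> = (\<integral>\<^sup>+y. ennreal (c ^ DIM('a)) * f y \<partial>lborel)"
    using c by (simp add: nn_integral_density nn_integral_distr)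
  finally show ?thesis by (simp add: nn_integral_cmult)
qed

text \<open>Taken as a function of centre and point, the indicator is symmetric and jointly
  measurable, as the exchanges of integrals below require.\<close>

definition ball_ind :: "real \<Rightarrow> 'a::metric_space \<Rightarrow> 'a \<Rightarrow> ennreal" where
  "ball_ind \<epsilon> x y = (if dist x y < \<epsilon> then 1 else 0)"

lemma ball_ind_commute: "ball_ind \<epsilon> x y = ball_ind \<epsilon> y x"
  by (simp add: ball_ind_def dist_commute)

lemma ball_ind_measurable [measurable]:
  fixes f g :: "'b \<Rightarrow> 'a::{metric_space, second_countable_topology}"
  assumes [measurable]: "f \<in> borel_measurable M" "g \<in> borel_measurable M"
  shows "(\<lambda>x. ball_ind \<epsilon> (f x) (g x)) \<in> borel_measurable M"
  unfolding ball_ind_def by measurable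

lemma nn_integral_ball_ind:
  fixes \<xi> :: "'a::euclidean_space"
  shows "\<epsilon> \<ge> 0 \<Longrightarrow> (\<integral>\<^sup>+x. ball_ind \<epsilon> \<xi> x \<partial>lborel) = ennreal (unit_ball_vol DIM('a) * \<epsilon> ^ DIM('a))"
proof -
  assume "\<epsilon> \<ge> 0"
  have "ball_ind \<epsilon> \<xi> = indicator (ball \<xi> \<epsilon>)"
    by (auto simp: ball_ind_def indicator_def)
  then show ?thesis using \<open>\<epsilon> \<ge> 0\<close> by (simp add: emeasure_ball)
qed

section \<open>Energy estimates for a probability measure with Fourier transform
  \<open>\<phi>\<close>\<close>

context
  fixes \<mu> :: "'a::euclidean_space measure" and \<phi> :: "'a \<Rightarrow> complex"
  assumes prob: "prob_space \<mu>" and sets_\<mu> [measurable_cong]: "sets \<mu> = sets borel"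
    and \<phi>: "\<And>y. \<phi> y = (\<integral>\<xi>. exp (\<i> * (y \<bullet> \<xi>)) \<partial>\<mu>)"
begin

interpretation prob_space \<mu> by (rule prob)
interpretation M2: pair_prob_space \<mu> \<mu> ..
interpretation PL: pair_sigma_finite "\<mu> \<Otimes>\<^sub>M \<mu>" "lborel :: 'a measure" ..
interpretation Lm: pair_sigma_finite "lborel :: 'a measure" \<mu> ..

lemma char_measurable [measurable]: "\<phi> \<in> borel_measurable borel"
  unfolding \<phi>[abs_def] by measurable

lemma char_norm_le_1: "norm (\<phi> y) \<le> 1"
  unfolding \<phi> by (rule order_trans[OF integral_norm_bound]) (simp add: prob_space)

text \<open>The Gaussian is the Fourier transform of \<open>gauss_density\<close>, so Fubini turns its double integral against
  \<open>\<mu> \<Otimes> \<mu>\<close> into an integral of \<open>|\<phi>|\<^sup>2\<close>.\<close>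

lemma gaussian_energy:
  assumes \<epsilon>: "\<epsilon> > 0"
  shows "(\<integral>\<^sup>+p. ennreal (exp (- (norm ((fst p - snd p) /\<^sub>R \<epsilon>))\<^sup>2 / 2)) \<partial>(\<mu> \<Otimes>\<^sub>M \<mu>)) \<le>
     ennreal (\<epsilon> ^ DIM('a)) * (\<integral>\<^sup>+y. ennreal ((norm (\<phi> y))\<^sup>2) \<partial>lborel)"
proof -
  define F where "F = (\<lambda>(p :: 'a \<times> 'a) z :: 'a. gauss_density z * exp (\<i> * (z \<bullet> ((fst p - snd p) /\<^sub>R \<epsilon>))))"
  have [measurable]: "case_prod F \<in> borel_measurable ((\<mu> \<Otimes>\<^sub>M \<mu>) \<Otimes>\<^sub>M lborel)"
    unfolding F_def by measurable
  have nF: "norm (F p z) = gauss_density z" for p z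
    unfolding F_def by (simp add: norm_mult gauss_density_nonneg)
  \<comment> \<open>The exponential has modulus 1, so the norm of \<open>F p z\<close> is
    \<open>gauss_density z\<close> for every \<open>p\<close>.\<close>
  have intF: "integrable ((\<mu> \<Otimes>\<^sub>M \<mu>) \<Otimes>\<^sub>M lborel) (case_prod F)"
  proof (rule PL.Fubini_integrable)
    show "AE p in \<mu> \<Otimes>\<^sub>M \<mu>. integrable lborel (\<lambda>z. case_prod F (p, z))"
      unfolding F_def prod.case by (intro AE_I2 gauss_density_fourier(1))
  qed (simp_all add: nF)
  \<comment> \<open>For fixed \<open>z\<close> the phase is a function of \<open>fst p\<close> times
    the conjugate of the same function of \<open>snd p\<close>, so the product measure yields
    \<open>\<phi>\<close> times its conjugate.\<close>
  have inner: "(\<integral>p. F p z \<partial>(\<mu> \<Otimes>\<^sub>M \<mu>)) = complex_of_real (gauss_density z * (norm (\<phi> (z /\<^sub>R \<epsilon>)))\<^sup>2)" for z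
  proof -
    let ?e = "\<lambda>\<xi>. exp (\<i> * ((z /\<^sub>R \<epsilon>) \<bullet> \<xi>))"
    have "F p z = gauss_density z * (?e (fst p) * cnj (?e (snd p)))" for p
      unfolding F_def
      by (simp add: exp_cnj exp_add[symmetric] inner_diff_right algebra_simps)
    then have "(\<integral>p. F p z \<partial>(\<mu> \<Otimes>\<^sub>M \<mu>)) = gauss_density z * (\<integral>p. ?e (fst p) * cnj (?e (snd p)) \<partial>(\<mu> \<Otimes>\<^sub>M \<mu>))"
      by simp
    also have "(\<integral>p. ?e (fst p) * cnj (?e (snd p)) \<partial>(\<mu> \<Otimes>\<^sub>M \<mu>)) = (\<integral>\<xi>. (\<integral>\<eta>. ?e \<xi> * cnj (?e \<eta>) \<partial>\<mu>) \<partial>\<mu>)"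
    proof (subst M2.integral_fst'[symmetric])
      have [measurable]: "cnj \<in> borel_measurable borel"
        by (intro borel_measurable_continuous_onI continuous_intros)
      show "integrable (\<mu> \<Otimes>\<^sub>M \<mu>) (\<lambda>p. ?e (fst p) * cnj (?e (snd p)))"
        by (rule M2.P.integrable_const_bound[where B = 1]) (simp add: norm_mult, measurable)
    qed simp
    also have "\<dots> = \<phi> (z /\<^sub>R \<epsilon>) * cnj (\<phi> (z /\<^sub>R \<epsilon>))"
      unfolding \<phi> by simp
    also have "\<dots> = complex_of_real ((norm (\<phi> (z /\<^sub>R \<epsilon>)))\<^sup>2)"
      by (simp only: complex_norm_square)
    finally show ?thesis by simp
  qed
  have "complex_of_real (\<integral>p. exp (- (norm ((fst p - snd p) /\<^sub>R \<epsilon>))\<^sup>2 / 2) \<partial>(\<mu> \<Otimes>\<^sub>M \<mu>)) =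
      (\<integral>p. (\<integral>z. F p z \<partial>lborel) \<partial>(\<mu> \<Otimes>\<^sub>M \<mu>))"
    unfolding F_def gauss_density_fourier(2) by (simp add: integral_complex_of_real)
  also have "\<dots> = (\<integral>z. (\<integral>p. F p z \<partial>(\<mu> \<Otimes>\<^sub>M \<mu>)) \<partial>lborel)"
    by (rule PL.Fubini_integral[OF intF, symmetric])
  also have "\<dots> = complex_of_real (\<integral>z. gauss_density z * (norm (\<phi> (z /\<^sub>R \<epsilon>)))\<^sup>2 \<partial>lborel)"
    unfolding inner by (rule integral_complex_of_real)
  finally have eq: "(\<integral>p. exp (- (norm ((fst p - snd p) /\<^sub>R \<epsilon>))\<^sup>2 / 2) \<partial>(\<mu> \<Otimes>\<^sub>M \<mu>)) =
      (\<integral>z. gauss_density z * (norm (\<phi> (z /\<^sub>R \<epsilon>)))\<^sup>2 \<partial>lborel)"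
    by (simp only: of_real_eq_iff)
  have "(\<integral>\<^sup>+p. ennreal (exp (- (norm ((fst p - snd p) /\<^sub>R \<epsilon>))\<^sup>2 / 2)) \<partial>(\<mu> \<Otimes>\<^sub>M \<mu>)) =
      ennreal (\<integral>p. exp (- (norm ((fst p - snd p) /\<^sub>R \<epsilon>))\<^sup>2 / 2) \<partial>(\<mu> \<Otimes>\<^sub>M \<mu>))"
    by (intro nn_integral_eq_integral M2.P.integrable_const_bound[where B = 1]) auto
  also have "\<dots> = (\<integral>\<^sup>+z. ennreal (gauss_density z * (norm (\<phi> (z /\<^sub>R \<epsilon>)))\<^sup>2) \<partial>lborel)"
    unfolding eq
  proof (intro nn_integral_eq_integral[symmetric] Bochner_Integration.integrable_bound[OF gauss_density_integrable] AE_I2)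
    show "norm (gauss_density z * (norm (\<phi> (z /\<^sub>R \<epsilon>)))\<^sup>2) \<le> norm (gauss_density z)" for z
      using char_norm_le_1[of "z /\<^sub>R \<epsilon>"]
      by (simp add: abs_mult power_le_one mult_left_le gauss_density_nonneg)
  qed (auto simp: gauss_density_nonneg)
  also have "\<dots> \<le> (\<integral>\<^sup>+z. ennreal ((norm (\<phi> (z /\<^sub>R \<epsilon>)))\<^sup>2) \<partial>lborel)"
    by (intro nn_integral_mono ennreal_leI mult_left_le_one_le gauss_density_nonneg gauss_density_le_1) auto
  also have "\<dots> = ennreal (\<epsilon> ^ DIM('a)) * (\<integral>\<^sup>+y. ennreal ((norm (\<phi> y))\<^sup>2) \<partial>lborel)"
    by (rule nn_integral_lborel_scale[OF _ \<epsilon>]) measurable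
  finally show ?thesis .
qed

text \<open>The squared mass of a ball is a double integral over \<mu>, and Tonelli turns its
  integral over \<open>x\<close> into volumes of intersections of balls. Centres of balls that meet
  are at most \<open>2 * \<epsilon>\<close> apart, where the Gaussian of
  \<open>gaussian_energy\<close> is at least \<open>exp (- 2)\<close>; hence the constant
  \<open>exp 2\<close>.\<close>

lemma ball_mass_square_integral:
  assumes \<epsilon>: "\<epsilon> > 0"
  shows "(\<integral>\<^sup>+x. (\<integral>\<^sup>+\<xi>. ball_ind \<epsilon> x \<xi> \<partial>\<mu>)\<^sup>2 \<partial>lborel) \<le>
    ennreal (unit_ball_vol DIM('a) * \<epsilon> ^ DIM('a)) * (ennreal (exp 2) *
      (ennreal (\<epsilon> ^ DIM('a)) * (\<integral>\<^sup>+y. ennreal ((norm (\<phi> y))\<^sup>2) \<partial>lborel)))"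
proof -
  define v where "v = ennreal (unit_ball_vol DIM('a) * \<epsilon> ^ DIM('a))"
  define G where "G = (\<lambda>p :: 'a \<times> 'a. ennreal (exp (- (norm ((fst p - snd p) /\<^sub>R \<epsilon>))\<^sup>2 / 2)))"
  have [measurable]: "G \<in> borel_measurable (\<mu> \<Otimes>\<^sub>M \<mu>)" unfolding G_def by measurable
  have "(\<integral>\<^sup>+x. (\<integral>\<^sup>+\<xi>. ball_ind \<epsilon> x \<xi> \<partial>\<mu>)\<^sup>2 \<partial>lborel) =
     (\<integral>\<^sup>+x. (\<integral>\<^sup>+p. ball_ind \<epsilon> (fst p) x * ball_ind \<epsilon> (snd p) x \<partial>(\<mu> \<Otimes>\<^sub>M \<mu>)) \<partial>lborel)"
  proof (rule nn_integral_cong)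
    fix x :: 'a
    have "(\<integral>\<^sup>+p. ball_ind \<epsilon> (fst p) x * ball_ind \<epsilon> (snd p) x \<partial>(\<mu> \<Otimes>\<^sub>M \<mu>)) =
        (\<integral>\<^sup>+\<xi>. \<integral>\<^sup>+\<eta>. ball_ind \<epsilon> \<xi> x * ball_ind \<epsilon> \<eta> x \<partial>\<mu> \<partial>\<mu>)"
      by (subst nn_integral_fst[symmetric]) simp_all
    also have "\<dots> = (\<integral>\<^sup>+\<xi>. ball_ind \<epsilon> \<xi> x \<partial>\<mu>) * (\<integral>\<^sup>+\<xi>. ball_ind \<epsilon> \<xi> x \<partial>\<mu>)"
      by (simp add: nn_integral_cmult nn_integral_multc)
    finally show "(\<integral>\<^sup>+\<xi>. ball_ind \<epsilon> x \<xi> \<partial>\<mu>)\<^sup>2 =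
        (\<integral>\<^sup>+p. ball_ind \<epsilon> (fst p) x * ball_ind \<epsilon> (snd p) x \<partial>(\<mu> \<Otimes>\<^sub>M \<mu>))"
      unfolding power2_eq_square ball_ind_commute[of \<epsilon> x] by (rule sym)
  qed
  also have "\<dots> = (\<integral>\<^sup>+p. (\<integral>\<^sup>+x. ball_ind \<epsilon> (fst p) x * ball_ind \<epsilon> (snd p) x \<partial>lborel) \<partial>(\<mu> \<Otimes>\<^sub>M \<mu>))"
    by (rule PL.Fubini') simp
  also have "\<dots> \<le> (\<integral>\<^sup>+p. v * (ennreal (exp 2) * G p) \<partial>(\<mu> \<Otimes>\<^sub>M \<mu>))"
  proof (rule nn_integral_mono)
    fix p :: "'a \<times> 'a"
    have "(\<integral>\<^sup>+x. ball_ind \<epsilon> (fst p) x * ball_ind \<epsilon> (snd p) x \<partial>lborel) \<le>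
        (\<integral>\<^sup>+x. ball_ind \<epsilon> (fst p) x * (ennreal (exp 2) * G p) \<partial>lborel)"
    proof (rule nn_integral_mono)
      fix x
      have "1 \<le> ennreal (exp 2) * G p" if "dist (fst p) x < \<epsilon>" "dist (snd p) x < \<epsilon>"
      proof -
        have "norm (fst p - snd p) \<le> 2 * \<epsilon>"
          using dist_triangle2[of "fst p" "snd p" x] that by (simp add: dist_norm)
        then have "norm ((fst p - snd p) /\<^sub>R \<epsilon>) \<le> 2"
          using \<epsilon> by (simp only: norm_scaleR) (simp add: field_simps)
        then have "(norm ((fst p - snd p) /\<^sub>R \<epsilon>))\<^sup>2 \<le> 2\<^sup>2" by (intro power_mono) auto
        then have "1 \<le> exp 2 * exp (- (norm ((fst p - snd p) /\<^sub>R \<epsilon>))\<^sup>2 / 2)"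
          unfolding exp_add[symmetric] by simp
        then show ?thesis unfolding G_def by (simp add: ennreal_mult[symmetric])
      qed
      then show "ball_ind \<epsilon> (fst p) x * ball_ind \<epsilon> (snd p) x \<le> ball_ind \<epsilon> (fst p) x * (ennreal (exp 2) * G p)"
        by (auto simp: ball_ind_def)
    qed
    also have "\<dots> = v * (ennreal (exp 2) * G p)"
      unfolding v_def using \<epsilon> by (simp add: nn_integral_multc nn_integral_ball_ind)
    finally show "(\<integral>\<^sup>+x. ball_ind \<epsilon> (fst p) x * ball_ind \<epsilon> (snd p) x \<partial>lborel) \<le> v * (ennreal (exp 2) * G p)" .
  qed
  also have "\<dots> = v * (ennreal (exp 2) * (\<integral>\<^sup>+p. G p \<partial>(\<mu> \<Otimes>\<^sub>M \<mu>)))"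
    by (simp add: nn_integral_cmult)
  also have "\<dots> \<le> v * (ennreal (exp 2) * (ennreal (\<epsilon> ^ DIM('a)) * (\<integral>\<^sup>+y. ennreal ((norm (\<phi> y))\<^sup>2) \<partial>lborel)))"
    unfolding G_def by (intro mult_left_mono gaussian_energy \<epsilon>) auto
  finally show ?thesis unfolding v_def .
qed

text \<open>Tonelli moves the averaging from \<open>g\<close> to \<mu>, and Cauchy-Schwarz separates
  \<open>g\<close> from the ball masses.\<close>

lemma ball_average_bound:
  fixes g :: "'a \<Rightarrow> ennreal"
  assumes g[measurable]: "g \<in> borel_measurable borel" and \<epsilon>: "\<epsilon> > 0"
  defines "v \<equiv> ennreal (unit_ball_vol DIM('a) * \<epsilon> ^ DIM('a))"
  shows "(\<integral>\<^sup>+\<xi>. (\<integral>\<^sup>+x. ball_ind \<epsilon> \<xi> x * g x \<partial>lborel) / v \<partial>\<mu>)\<^sup>2 \<le>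
    ennreal (exp 2 / unit_ball_vol DIM('a)) * (\<integral>\<^sup>+y. ennreal ((norm (\<phi> y))\<^sup>2) \<partial>lborel) * (\<integral>\<^sup>+x. (g x)\<^sup>2 \<partial>lborel)"
proof -
  define I where "I = (\<integral>\<^sup>+y. ennreal ((norm (\<phi> y))\<^sup>2) \<partial>lborel)"
  define V where "V = unit_ball_vol DIM('a)"
  have V: "V > 0" unfolding V_def by simp
  have "(\<integral>\<^sup>+\<xi>. (\<integral>\<^sup>+x. ball_ind \<epsilon> \<xi> x * g x \<partial>lborel) / v \<partial>\<mu>) =
     (\<integral>\<^sup>+\<xi>. (\<integral>\<^sup>+x. ball_ind \<epsilon> \<xi> x * g x \<partial>lborel) \<partial>\<mu>) / v"
    by (rule nn_integral_divide) measurable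
  also have "(\<integral>\<^sup>+\<xi>. (\<integral>\<^sup>+x. ball_ind \<epsilon> \<xi> x * g x \<partial>lborel) \<partial>\<mu>) = (\<integral>\<^sup>+x. (\<integral>\<^sup>+\<xi>. ball_ind \<epsilon> \<xi> x * g x \<partial>\<mu>) \<partial>lborel)"
    by (rule Lm.Fubini') simp
  also have "\<dots> = (\<integral>\<^sup>+x. g x * (\<integral>\<^sup>+\<xi>. ball_ind \<epsilon> x \<xi> \<partial>\<mu>) \<partial>lborel)"
  proof (rule nn_integral_cong)
    fix x :: 'a
    show "(\<integral>\<^sup>+\<xi>. ball_ind \<epsilon> \<xi> x * g x \<partial>\<mu>) = g x * (\<integral>\<^sup>+\<xi>. ball_ind \<epsilon> x \<xi> \<partial>\<mu>)"
      unfolding ball_ind_commute[of \<epsilon> x] by (subst nn_integral_multc) (simp_all add: mult.commute)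
  qed
  finally have eq: "(\<integral>\<^sup>+\<xi>. (\<integral>\<^sup>+x. ball_ind \<epsilon> \<xi> x * g x \<partial>lborel) / v \<partial>\<mu>) =
    (\<integral>\<^sup>+x. g x * (\<integral>\<^sup>+\<xi>. ball_ind \<epsilon> x \<xi> \<partial>\<mu>) \<partial>lborel) / v" .
  have "(\<integral>\<^sup>+x. g x * (\<integral>\<^sup>+\<xi>. ball_ind \<epsilon> x \<xi> \<partial>\<mu>) \<partial>lborel)\<^sup>2 \<le>
     (\<integral>\<^sup>+x. (g x)\<^sup>2 \<partial>lborel) * (\<integral>\<^sup>+x. (\<integral>\<^sup>+\<xi>. ball_ind \<epsilon> x \<xi> \<partial>\<mu>)\<^sup>2 \<partial>lborel)"
    by (rule Cauchy_Schwarz_nn_integral) measurable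
  also have "\<dots> \<le> (\<integral>\<^sup>+x. (g x)\<^sup>2 \<partial>lborel) * (v * (ennreal (exp 2) * (ennreal (\<epsilon> ^ DIM('a)) * I)))"
    unfolding v_def I_def by (intro mult_left_mono ball_mass_square_integral \<epsilon>) auto
  also have "\<dots> = (ennreal (exp 2 / V) * I * (\<integral>\<^sup>+x. (g x)\<^sup>2 \<partial>lborel)) * v\<^sup>2"
  proof -
    \<comment> \<open>Here the powers of \<open>\<epsilon>\<close> cancel against the normalization
      by \<open>v\<close>, so the final bound does not depend on the radius.\<close>
    have "v * (ennreal (exp 2) * ennreal (\<epsilon> ^ DIM('a))) = ennreal (exp 2 / V) * v\<^sup>2"
      unfolding v_def V_def[symmetric] using V \<epsilon>
      by (simp add: ennreal_mult[symmetric] power2_eq_square)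
    then show ?thesis by (simp add: mult_ac)
  qed
  finally have *: "(\<integral>\<^sup>+x. g x * (\<integral>\<^sup>+\<xi>. ball_ind \<epsilon> x \<xi> \<partial>\<mu>) \<partial>lborel)\<^sup>2 * (inverse v)\<^sup>2 \<le>
     (ennreal (exp 2 / V) * I * (\<integral>\<^sup>+x. (g x)\<^sup>2 \<partial>lborel)) * v\<^sup>2 * (inverse v)\<^sup>2"
    by (rule mult_right_mono) simp
  have "v\<^sup>2 * (inverse v)\<^sup>2 = 1"
    using V \<epsilon> unfolding v_def V_def[symmetric] power_mult_distrib[symmetric]
    by (simp add: inverse_ennreal ennreal_mult[symmetric]) (simp add: field_simps)
  with * show ?thesis
    unfolding eq I_def[symmetric] V_def[symmetric]
    by (simp add: divide_ennreal_def power_mult_distrib mult.assoc)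
qed

text \<open>Averaging over small balls recovers a lower semicontinuous function in the limit.\<close>

lemma lower_semicontinuous_energy_bound:
  fixes g :: "'a \<Rightarrow> ennreal"
  assumes g[measurable]: "g \<in> borel_measurable borel" and lsc: "\<And>a. open {x. a < g x}"
  shows "(\<integral>\<^sup>+\<xi>. g \<xi> \<partial>\<mu>)\<^sup>2 \<le>
    ennreal (exp 2 / unit_ball_vol DIM('a)) * (\<integral>\<^sup>+y. ennreal ((norm (\<phi> y))\<^sup>2) \<partial>lborel) * (\<integral>\<^sup>+x. (g x)\<^sup>2 \<partial>lborel)"
    (is "_ \<le> ?B")
proof (cases "?B")
  case (real r)
  define \<epsilon> where "\<epsilon> = (\<lambda>n. inverse (real (Suc n)))"
  define v where "v = (\<lambda>n. ennreal (unit_ball_vol DIM('a) * \<epsilon> n ^ DIM('a)))"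
  define Av where "Av = (\<lambda>n \<xi>. (\<integral>\<^sup>+x. ball_ind (\<epsilon> n) \<xi> x * g x \<partial>lborel) / v n)"
  have \<epsilon>: "\<epsilon> n > 0" for n unfolding \<epsilon>_def by simp
  have \<epsilon>_lim: "\<epsilon> \<longlonglongrightarrow> 0" unfolding \<epsilon>_def by (rule LIMSEQ_inverse_real_of_nat)
  \<comment> \<open>Below \<open>g \<xi>\<close> choose \<open>b\<close>; on all sufficiently small
    balls around \<open>\<xi>\<close> the function exceeds \<open>b\<close>, hence so does its
    average, at least weakly.\<close>
  have lim: "g \<xi> \<le> liminf (\<lambda>n. Av n \<xi>)" for \<xi>
    unfolding le_Liminf_iff
  proof (intro allI impI)
    fix a assume "a < g \<xi>"
    then obtain b where b: "a < b" "b < g \<xi>" using dense by blast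
    obtain \<delta> where \<delta>: "\<delta> > 0" "ball \<xi> \<delta> \<subseteq> {x. b < g x}"
      using openE[OF lsc[of b], of \<xi>] b(2) by auto
    have "eventually (\<lambda>n. \<epsilon> n < \<delta>) sequentially"
      using order_tendstoD(2)[OF \<epsilon>_lim \<delta>(1)] .
    then show "eventually (\<lambda>n. a < Av n \<xi>) sequentially"
    proof eventually_elim
      case (elim n)
      have "b * v n = (\<integral>\<^sup>+x. ball_ind (\<epsilon> n) \<xi> x * b \<partial>lborel)"
        using \<epsilon>[of n] unfolding v_def by (subst nn_integral_multc) (simp_all add: nn_integral_ball_ind mult.commute)
      also have "\<dots> \<le> (\<integral>\<^sup>+x. ball_ind (\<epsilon> n) \<xi> x * g x \<partial>lborel)"
      proof (rule nn_integral_mono)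
        fix x :: 'a
        have "b < g x" if "dist \<xi> x < \<epsilon> n" using subsetD[OF \<delta>(2), of x] elim that by simp
        then show "ball_ind (\<epsilon> n) \<xi> x * b \<le> ball_ind (\<epsilon> n) \<xi> x * g x"
          by (auto simp: ball_ind_def)
      qed
      finally have "b * v n / v n \<le> Av n \<xi>"
        unfolding Av_def by (rule divide_right_mono_ennreal)
      moreover have "b * v n / v n = b"
        unfolding v_def using \<epsilon>[of n] by (intro ennreal_mult_divide_eq) (auto simp: ennreal_eq_0_iff not_le)
      ultimately show ?case using b(1) by simp
    qed
  qed
  have Av_bound: "(\<integral>\<^sup>+\<xi>. Av n \<xi> \<partial>\<mu>) \<le> ennreal (sqrt r)" for n
  proof -
    have "(\<integral>\<^sup>+\<xi>. Av n \<xi> \<partial>\<mu>)\<^sup>2 \<le> ennreal r"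
      using ball_average_bound[OF g \<epsilon>[of n]] unfolding Av_def v_def real(2) .
    then show ?thesis
    proof (cases "\<integral>\<^sup>+\<xi>. Av n \<xi> \<partial>\<mu>")
      case (real s)
      with \<open>(\<integral>\<^sup>+\<xi>. Av n \<xi> \<partial>\<mu>)\<^sup>2 \<le> ennreal r\<close> have "s\<^sup>2 \<le> r"
        using \<open>0 \<le> r\<close> by (simp add: ennreal_power)
      then show ?thesis unfolding real by (intro ennreal_leI real_le_rsqrt)
    qed (simp add: power2_eq_square ennreal_mult_top top_unique)
  qed
  \<comment> \<open>Fatou's lemma transfers the uniform bound on the averages to
    \<open>g\<close>.\<close>
  have "(\<integral>\<^sup>+\<xi>. g \<xi> \<partial>\<mu>) \<le> (\<integral>\<^sup>+\<xi>. liminf (\<lambda>n. Av n \<xi>) \<partial>\<mu>)"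
    by (intro nn_integral_mono lim)
  also have "\<dots> \<le> liminf (\<lambda>n. \<integral>\<^sup>+\<xi>. Av n \<xi> \<partial>\<mu>)"
    unfolding Av_def by (rule nn_integral_liminf) measurable
  also have "\<dots> \<le> limsup (\<lambda>n. \<integral>\<^sup>+\<xi>. Av n \<xi> \<partial>\<mu>)"
    by (rule Liminf_le_Limsup) simp
  also have "\<dots> \<le> ennreal (sqrt r)"
    by (rule Limsup_bounded) (simp add: Av_bound)
  finally have "(\<integral>\<^sup>+\<xi>. g \<xi> \<partial>\<mu>)\<^sup>2 \<le> (ennreal (sqrt r))\<^sup>2"
    by (intro power_mono) auto
  also have "\<dots> = ?B" using real by (simp add: ennreal_power)
  finally show ?thesis .
qed simp

text \<open>By outer regularity a Lebesgue null set lies in open sets of arbitrarily small volume.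
  Their indicators are lower semicontinuous, so the energy bound makes their mass under \<mu>
  arbitrarily small.\<close>

lemma square_integrable_char_absolutely_continuous:
  assumes fin: "(\<integral>\<^sup>+y. ennreal ((norm (\<phi> y))\<^sup>2) \<partial>lborel) < \<infinity>"
  shows "absolutely_continuous lborel \<mu>"
  unfolding absolutely_continuous_def
proof
  fix A :: "'a set" assume A: "A \<in> null_sets lborel"
  then have A_sets: "A \<in> sets borel" by auto
  define c where "c = ennreal (exp 2 / unit_ball_vol DIM('a)) * (\<integral>\<^sup>+y. ennreal ((norm (\<phi> y))\<^sup>2) \<partial>lborel)"
  have "c < \<infinity>" unfolding c_def using fin by (simp add: ennreal_mult_less_top)
  then obtain c' where c': "c = ennreal c'" "c' \<ge> 0" by (cases c) auto
  define m where "m = measure \<mu> A"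
  have "m\<^sup>2 \<le> 0 + e" if e: "e > 0" for e
  proof -
    \<comment> \<open>The summand 1 keeps the denominator positive when \<open>c'\<close> is
      0.\<close>
    define e' where "e' = e / (c' + 1)"
    have e': "e' > 0" unfolding e'_def using e c' by simp
    obtain U where U: "open U" "A \<subseteq> U" "emeasure lborel (U - A) < ennreal e'"
      using outer_regular_lborel[OF A_sets e'] by blast
    have U_sets[measurable]: "U \<in> sets borel" using U(1) by simp
    have "emeasure lborel U = emeasure lborel (U - A)"
      using A U_sets by (intro emeasure_Diff_null_set[symmetric]) auto
    then have vol: "emeasure lborel U \<le> ennreal e'" using U(3) by simp
    have "ennreal (m\<^sup>2) = (emeasure \<mu> A)\<^sup>2"
      unfolding m_def by (simp add: emeasure_eq_measure ennreal_power)
    also have "\<dots> \<le> (emeasure \<mu> U)\<^sup>2"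
      using U(2) by (intro power_mono emeasure_mono) (auto simp: sets_\<mu>)
    also have "\<dots> = (\<integral>\<^sup>+\<xi>. indicator U \<xi> \<partial>\<mu>)\<^sup>2" by (simp add: sets_\<mu>)
    also have "\<dots> \<le> c * (\<integral>\<^sup>+x. (indicator U x)\<^sup>2 \<partial>lborel)"
      unfolding c_def
    proof (rule lower_semicontinuous_energy_bound)
      show "open {x. a < (indicator U x :: ennreal)}" for a
      proof -
        have "{x. a < (indicator U x :: ennreal)} = (if a < 1 then U else {})"
          by (auto simp: indicator_def)
        then show ?thesis using U(1) by simp
      qed
    qed simp
    also have "(\<lambda>x. (indicator U x :: ennreal)\<^sup>2) = indicator U" by (auto simp: indicator_def)
    also have "(\<integral>\<^sup>+x. indicator U x \<partial>lborel) = emeasure lborel U" by simp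
    also have "c * emeasure lborel U \<le> ennreal c' * ennreal e'"
      unfolding c' by (intro mult_left_mono vol) simp
    also have "\<dots> = ennreal (c' * e')" using c' e' by (simp add: ennreal_mult)
    finally have "m\<^sup>2 \<le> c' * e'" using c' e' by simp
    also have "\<dots> \<le> e" unfolding e'_def using c' e by (simp add: field_simps)
    finally show ?thesis by simp
  qed
  then have "m\<^sup>2 \<le> 0" by (rule field_le_epsilon)
  then have "emeasure \<mu> A = 0" unfolding m_def by (simp add: emeasure_eq_measure)
  then show "A \<in> null_sets \<mu>" using A_sets by (simp add: null_sets_def sets_\<mu>)
qed

text \<open>Lower semicontinuity is traded for boundedness and bounded support: \<open>g\<close> is
  a Lebesgue almost everywhere limit of continuous functions, the bound holds for these, and
  dominated convergence applies on both sides.\<close>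

lemma bounded_support_energy_bound:
  fixes g :: "'a \<Rightarrow> real"
  assumes fin: "(\<integral>\<^sup>+y. ennreal ((norm (\<phi> y))\<^sup>2) \<partial>lborel) < \<infinity>"
    and g[measurable]: "g \<in> borel_measurable borel" and g0: "\<And>x. 0 \<le> g x" and gb: "\<And>x. g x \<le> b"
    and supp: "\<And>x. norm x \<ge> r \<Longrightarrow> g x = 0"
  shows "(\<integral>\<^sup>+\<xi>. ennreal (g \<xi>) \<partial>\<mu>)\<^sup>2 \<le>
    ennreal (exp 2 / unit_ball_vol DIM('a)) * (\<integral>\<^sup>+y. ennreal ((norm (\<phi> y))\<^sup>2) \<partial>lborel) *
      (\<integral>\<^sup>+x. ennreal ((g x)\<^sup>2) \<partial>lborel)"
proof -
  define c where "c = ennreal (exp 2 / unit_ball_vol DIM('a)) * (\<integral>\<^sup>+y. ennreal ((norm (\<phi> y))\<^sup>2) \<partial>lborel)"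
  have c: "c < \<infinity>" unfolding c_def using fin by (simp add: ennreal_mult_less_top)
  have b0: "b \<ge> 0" using g0[of 0] gb[of 0] by simp
  have "g measurable_on UNIV"
    by (rule lebesgue_measurable_imp_measurable_on) (auto intro: measurable_completion)
  then obtain N h where N: "negligible N" and h: "\<And>m::nat. continuous_on UNIV (h m)"
    and hlim: "\<And>x. x \<notin> N \<Longrightarrow> (\<lambda>m. h m x) \<longlonglongrightarrow> g x"
    unfolding measurable_on_def by auto
  have [measurable]: "cball (0::'a) (r + 1) \<in> sets borel" by (intro borel_closed closed_cball)
  \<comment> \<open>Clamping to the range from 0 to \<open>b\<close> and cutting off outside radius
    \<open>r + 1\<close> give a common majorant. The cutoff is 1 up to radius \<open>r\<close>, so
    the limit is still \<open>g\<close>.\<close>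
  define H where "H = (\<lambda>m x. max 0 (min b (h m x)) * max 0 (min 1 (r + 1 - norm x)))"
  have H_cont: "continuous_on UNIV (H m)" for m
    unfolding H_def by (intro continuous_intros h)
  have [measurable]: "H m \<in> borel_measurable borel" for m
    by (rule borel_measurable_continuous_onI[OF H_cont])
  have H0: "0 \<le> H m x" for m x unfolding H_def by simp
  have Hb: "H m x \<le> b * indicator (cball 0 (r + 1)) x" for m x
  proof (cases "norm x \<le> r + 1")
    case True
    have "H m x \<le> b * 1" unfolding H_def using b0 by (intro mult_mono) auto
    with True show ?thesis by simp
  qed (simp add: H_def)
  have AE_lb: "AE x in lborel. x \<notin> N"
  proof -
    have "AE x in lebesgue. x \<notin> N" using N by (intro AE_not_in) (simp add: negligible_iff_null_sets)
    then show ?thesis by (simp add: AE_completion_iff)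
  qed
  have H_lim: "(\<lambda>m. H m x) \<longlonglongrightarrow> g x" if "x \<notin> N" for x
  proof -
    have "(\<lambda>m. H m x) \<longlonglongrightarrow> max 0 (min b (g x)) * max 0 (min 1 (r + 1 - norm x))"
      unfolding H_def by (intro tendsto_intros hlim that)
    moreover have "max 0 (min b (g x)) * max 0 (min 1 (r + 1 - norm x)) = g x"
      using g0[of x] gb[of x] supp[of x] by (cases "norm x \<ge> r") auto
    ultimately show ?thesis by simp
  qed
  have bound: "(\<integral>\<^sup>+\<xi>. ennreal (H m \<xi>) \<partial>\<mu>)\<^sup>2 \<le> c * (\<integral>\<^sup>+x. ennreal ((H m x)\<^sup>2) \<partial>lborel)" for m
  proof -
    have "open {x. a < ennreal (H m x)}" for a
      by (intro open_Collect_less continuous_on_const continuous_on_ennreal H_cont)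
    from lower_semicontinuous_energy_bound[OF _ this]
    show ?thesis unfolding c_def by (simp add: ennreal_power H0)
  qed
  have lim1: "(\<lambda>m. \<integral>\<^sup>+\<xi>. ennreal (H m \<xi>) \<partial>\<mu>) \<longlonglongrightarrow> (\<integral>\<^sup>+\<xi>. ennreal (g \<xi>) \<partial>\<mu>)"
  proof (rule nn_integral_dominated_convergence)
    show "AE x in \<mu>. ennreal (H m x) \<le> ennreal b" for m
    proof (intro AE_I2 ennreal_leI)
      fix x :: 'a
      have "b * indicator (cball 0 (r + 1)) x \<le> b" using b0 by (simp add: indicator_def)
      with Hb[of m x] show "H m x \<le> b" by linarith
    qed
    show "(\<integral>\<^sup>+x. ennreal b \<partial>\<mu>) < \<infinity>" by (simp add: emeasure_space_1)
    \<comment> \<open>Absolute continuity carries the convergence over to \<mu>.\<close>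
    have "AE x in \<mu>. x \<notin> N"
      by (rule absolutely_continuous_AE[OF _ square_integrable_char_absolutely_continuous[OF fin] AE_lb])
        (simp add: sets_\<mu>)
    then show "AE x in \<mu>. (\<lambda>m. ennreal (H m x)) \<longlonglongrightarrow> ennreal (g x)"
      by eventually_elim (intro tendsto_ennrealI H_lim)
  qed measurable
  have fin_g: "(\<integral>\<^sup>+x. ennreal (b\<^sup>2) * indicator (cball (0::'a) (r + 1)) x \<partial>lborel) < \<infinity>"
    by (subst nn_integral_cmult_indicator) (simp_all add: ennreal_mult_less_top emeasure_lborel_cball_finite[unfolded infinity_ennreal_def])
  have lim2: "(\<lambda>m. \<integral>\<^sup>+x. ennreal ((H m x)\<^sup>2) \<partial>lborel) \<longlonglongrightarrow> (\<integral>\<^sup>+x. ennreal ((g x)\<^sup>2) \<partial>lborel)"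
  proof (rule nn_integral_dominated_convergence[OF _ _ _ _ fin_g])
    show "AE x in lborel. ennreal ((H m x)\<^sup>2) \<le> ennreal (b\<^sup>2) * indicator (cball 0 (r + 1)) x" for m
    proof (rule AE_I2)
      fix x
      have "(H m x)\<^sup>2 \<le> (b * indicator (cball 0 (r + 1)) x)\<^sup>2"
        by (intro power_mono Hb H0)
      then show "ennreal ((H m x)\<^sup>2) \<le> ennreal (b\<^sup>2) * indicator (cball 0 (r + 1)) x"
        by (auto simp: indicator_def intro!: ennreal_leI)
    qed
    show "AE x in lborel. (\<lambda>m. ennreal ((H m x)\<^sup>2)) \<longlonglongrightarrow> ennreal ((g x)\<^sup>2)"
      using AE_lb by eventually_elim (intro tendsto_ennrealI tendsto_power H_lim)
  qed measurable
  have fin_\<mu>: "(\<integral>\<^sup>+\<xi>. ennreal (g \<xi>) \<partial>\<mu>) \<noteq> \<infinity>"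
  proof -
    have "(\<integral>\<^sup>+\<xi>. ennreal (g \<xi>) \<partial>\<mu>) \<le> (\<integral>\<^sup>+\<xi>. ennreal b \<partial>\<mu>)"
      by (intro nn_integral_mono ennreal_leI gb)
    then show ?thesis by (auto simp: emeasure_space_1 top_unique)
  qed
  have "(\<lambda>m. (\<integral>\<^sup>+\<xi>. ennreal (H m \<xi>) \<partial>\<mu>)\<^sup>2) \<longlonglongrightarrow> (\<integral>\<^sup>+\<xi>. ennreal (g \<xi>) \<partial>\<mu>)\<^sup>2"
    unfolding power2_eq_square using fin_\<mu> by (intro tendsto_mult_ennreal lim1) auto
  moreover have "(\<lambda>m. c * (\<integral>\<^sup>+x. ennreal ((H m x)\<^sup>2) \<partial>lborel)) \<longlonglongrightarrow> c * (\<integral>\<^sup>+x. ennreal ((g x)\<^sup>2) \<partial>lborel)"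
    using c by (intro ennreal_tendsto_cmult lim2) auto
  ultimately show ?thesis
    unfolding c_def[symmetric] by (rule LIMSEQ_le) (use bound in auto)
qed

text \<open>The energy bound is tested on truncations \<open>g n\<close> of the density
  \<open>f\<close> itself. With \<open>q\<close> the integral of \<open>(g n x)\<^sup>2\<close>, the
  inequality \<open>g n x \<le> f x\<close> bounds \<open>q\<close> by the integral of
  \<open>g n\<close> against \<mu>, so \<open>q\<^sup>2 \<le> c * q\<close> and
  \<open>q \<le> c\<close> for every \<open>n\<close>.\<close>

lemma square_integrable_char_density:
  assumes fin: "(\<integral>\<^sup>+y. ennreal ((norm (\<phi> y))\<^sup>2) \<partial>lborel) < \<infinity>"
  shows "\<exists>f :: 'a \<Rightarrow> real. f \<in> borel_measurable lborel \<and> (\<forall>x. 0 \<le> f x) \<and>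
    \<mu> = density lborel (\<lambda>x. ennreal (f x)) \<and> integrable lborel (\<lambda>x. (f x)\<^sup>2)"
proof -
  define c where "c = ennreal (exp 2 / unit_ball_vol DIM('a)) * (\<integral>\<^sup>+y. ennreal ((norm (\<phi> y))\<^sup>2) \<partial>lborel)"
  have c: "c < \<infinity>" unfolding c_def using fin by (simp add: ennreal_mult_less_top)
  obtain F where F[measurable]: "F \<in> borel_measurable (lborel :: 'a measure)" and dF: "density lborel F = \<mu>"
    using sigma_finite_measure.Radon_Nikodym[OF sigma_finite_lborel square_integrable_char_absolutely_continuous[OF fin]] sets_\<mu> by auto
  define f where "f = (\<lambda>x. enn2real (F x))"
  have [measurable]: "f \<in> borel_measurable borel" unfolding f_def by measurable
  have f0: "0 \<le> f x" for x unfolding f_def by simp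
  have "(\<integral>\<^sup>+x. F x \<partial>lborel) = emeasure \<mu> UNIV"
    unfolding dF[symmetric] by (subst emeasure_density) auto
  also have "\<dots> = 1" using emeasure_space_1 sets_eq_imp_space_eq[OF sets_\<mu>] by simp
  finally have "AE x in lborel. F x \<noteq> \<infinity>" by (intro nn_integral_PInf_AE) auto
  then have "AE x in lborel. F x = ennreal (f x)"
    by eventually_elim (simp add: f_def less_top)
  then have df: "\<mu> = density lborel (\<lambda>x. ennreal (f x))"
    unfolding dF[symmetric] by (intro density_cong) auto
  \<comment> \<open>Truncating both height and support makes \<open>q\<close> finite, which permits
    dividing by it.\<close>
  define g where "g = (\<lambda>n x. if norm x < real n then min (f x) (real n) else 0)"
  have [measurable]: "g n \<in> borel_measurable borel" for n unfolding g_def by measurable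
  have g_props: "0 \<le> g n x" "g n x \<le> real n" "g n x \<le> f x" for n x
    unfolding g_def using f0[of x] by auto
  have g_bound: "(\<integral>\<^sup>+x. ennreal ((g n x)\<^sup>2) \<partial>lborel) \<le> c" for n
  proof -
    define q where "q = (\<integral>\<^sup>+x. ennreal ((g n x)\<^sup>2) \<partial>lborel)"
    have "q \<le> (\<integral>\<^sup>+x. ennreal ((real n)\<^sup>2) * indicator (cball (0::'a) (real n)) x \<partial>lborel)"
      unfolding q_def
    proof (rule nn_integral_mono)
      fix x
      have "(g n x)\<^sup>2 \<le> (real n)\<^sup>2" using g_props by (intro power_mono) auto
      then show "ennreal ((g n x)\<^sup>2) \<le> ennreal ((real n)\<^sup>2) * indicator (cball 0 (real n)) x"
        by (auto simp: indicator_def g_def intro!: ennreal_leI split: if_splits)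
    qed
    also have "\<dots> < \<infinity>"
      by (subst nn_integral_cmult_indicator) (simp_all add: ennreal_mult_less_top emeasure_lborel_cball_finite[unfolded infinity_ennreal_def])
    finally have q: "q < \<infinity>" .
    have "q \<le> (\<integral>\<^sup>+x. ennreal (f x) * ennreal (g n x) \<partial>lborel)"
      unfolding q_def using g_props f0
      by (intro nn_integral_mono) (auto simp: power2_eq_square ennreal_mult[symmetric] intro!: ennreal_leI mult_right_mono)
    also have "\<dots> = (\<integral>\<^sup>+\<xi>. ennreal (g n \<xi>) \<partial>\<mu>)"
      unfolding df by (subst nn_integral_density) auto
    finally have "q\<^sup>2 \<le> (\<integral>\<^sup>+\<xi>. ennreal (g n \<xi>) \<partial>\<mu>)\<^sup>2" by (intro power_mono) auto
    also have "\<dots> \<le> c * q"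
      unfolding c_def q_def
      by (rule bounded_support_energy_bound[OF fin, where b = "real n" and r = "real n"]) (use g_props in \<open>auto simp: g_def\<close>)
    finally have "q * q \<le> q * c" by (simp add: power2_eq_square mult.commute)
    then show ?thesis
      using q unfolding q_def[symmetric] by (cases "q = 0") (auto simp: ennreal_mult_le_mult_iff)
  qed
  \<comment> \<open>At each point the truncations eventually equal \<open>f\<close>; Fatou's lemma
    then passes the bound \<open>c\<close> to the limit.\<close>
  have "(\<integral>\<^sup>+x. ennreal ((f x)\<^sup>2) \<partial>lborel) = (\<integral>\<^sup>+x. liminf (\<lambda>n. ennreal ((g n x)\<^sup>2)) \<partial>lborel)"
  proof (rule nn_integral_cong)
    fix x
    obtain n0 :: nat where n0: "max (norm x) (f x) < real n0" using reals_Archimedean2 by blast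
    have "eventually (\<lambda>n. ennreal ((g n x)\<^sup>2) = ennreal ((f x)\<^sup>2)) sequentially"
      using eventually_ge_at_top[of n0] by eventually_elim (use n0 in \<open>auto simp: g_def min_def\<close>)
    then have "(\<lambda>n. ennreal ((g n x)\<^sup>2)) \<longlonglongrightarrow> ennreal ((f x)\<^sup>2)" by (rule tendsto_eventually)
    then show "ennreal ((f x)\<^sup>2) = liminf (\<lambda>n. ennreal ((g n x)\<^sup>2))"
      by (rule lim_imp_Liminf[OF sequentially_bot, symmetric])
  qed
  also have "\<dots> \<le> liminf (\<lambda>n. \<integral>\<^sup>+x. ennreal ((g n x)\<^sup>2) \<partial>lborel)"
    by (rule nn_integral_liminf) measurable
  also have "\<dots> \<le> limsup (\<lambda>n. \<integral>\<^sup>+x. ennreal ((g n x)\<^sup>2) \<partial>lborel)" by (rule Liminf_le_Limsup) simp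
  also have "\<dots> \<le> c" by (rule Limsup_bounded) (simp add: g_bound)
  finally have "(\<integral>\<^sup>+x. ennreal ((f x)\<^sup>2) \<partial>lborel) < \<infinity>" using c by simp
  then have "integrable lborel (\<lambda>x. (f x)\<^sup>2)" by (intro integrableI_bounded) auto
  with df f0 show ?thesis by (intro exI[of _ f]) auto
qed

end

section \<open>Application to the representing measure of the Dunkl kernel\<close>

theorem theorem7p2:
  fixes R P :: "'a::euclidean_space set"
    and k :: "'a \<Rightarrow> real"
    and E :: "'a cplxn \<Rightarrow> 'a cplxn \<Rightarrow> complex"
    and l :: 'a
    and \<mu> :: "'a measure"
  assumes "normalized_root_system R"
    and "positive_system R P"
    and "multiplicity_function R k"
    and "\<And>\<alpha>. \<alpha> \<in> R \<Longrightarrow> k \<alpha> > 1 / 2"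
    and "is_dunkl_kernel P (\<lambda>\<alpha>. complex_of_real (k \<alpha>)) E"
    and "l \<in> regular_points R"
    and "is_representing_measure E l \<mu>"
  shows "absolutely_continuous lborel \<mu> \<and>
    (\<exists>f :: 'a \<Rightarrow> real. f \<in> borel_measurable lborel \<and> (\<forall>x. 0 \<le> f x) \<and>
       \<mu> = density lborel (\<lambda>x. ennreal (f x)) \<and>
       integrable lborel (\<lambda>x. (f x)\<^sup>2))"
proof -
  have k0: "k \<alpha> \<ge> 0" if "\<alpha> \<in> R" for \<alpha> using assms(4)[OF that] by simp
  obtain A C where A: "A > 0" and C: "C > 0"
    and bound: "\<And>x. (norm (E (of_real_vec l) (0, x)))\<^sup>2 \<le>
      C * exp (- (\<Sum>\<alpha>\<in>R. k \<alpha> / 2 * ln (1 + ((\<alpha> \<bullet> x) / A)\<^sup>2)))"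
    using dunkl_kernel_imaginary_decay[OF assms(1-3) k0 assms(5,6)] by auto
  define \<phi> where "\<phi> = (\<lambda>y. E (of_real_vec l) (0, y))"
  have prob: "prob_space \<mu>" and sets_\<mu>: "sets \<mu> = sets borel"
    and rep: "\<And>z. E (of_real_vec l) z = (\<integral>\<xi>. exp (cform z (of_real_vec \<xi>)) \<partial>\<mu>)"
    using assms(7) unfolding is_representing_measure_def by auto
  \<comment> \<open>At purely imaginary arguments the Laplace-type representation becomes the
    Fourier transform of \<mu>.\<close>
  have cf: "cform (0, y) (of_real_vec \<xi>) = \<i> * (y \<bullet> \<xi>)" for y \<xi> :: 'a
    by (simp add: cform_def of_real_vec_def complex_eq_iff)
  have \<phi>: "\<phi> y = (\<integral>\<xi>. exp (\<i> * (y \<bullet> \<xi>)) \<partial>\<mu>)" for y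
    unfolding \<phi>_def rep cf ..
  have "(\<integral>\<^sup>+x. ennreal ((norm (\<phi> x))\<^sup>2) \<partial>lborel) \<le>
     (\<integral>\<^sup>+x. ennreal C * ennreal (exp (- (\<Sum>\<alpha>\<in>R. k \<alpha> / 2 * ln (1 + ((\<alpha> \<bullet> x) / A)\<^sup>2)))) \<partial>lborel)"
    unfolding \<phi>_def using C bound
    by (intro nn_integral_mono) (simp add: ennreal_mult[symmetric] ennreal_leI)
  also have "\<dots> = ennreal C *
     (\<integral>\<^sup>+x. ennreal (exp (- (\<Sum>\<alpha>\<in>R. k \<alpha> / 2 * ln (1 + ((\<alpha> \<bullet> x) / A)\<^sup>2)))) \<partial>lborel)"
    by (rule nn_integral_cmult) measurable
  also have "\<dots> < \<infinity>"
  proof -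
    have "(\<integral>\<^sup>+x. ennreal (exp (- (\<Sum>\<alpha>\<in>R. k \<alpha> / 2 * ln (1 + ((\<alpha> \<bullet> x) / A)\<^sup>2)))) \<partial>lborel) < \<infinity>"
    proof (rule root_system_decay_integrable)
      show "finite R" "span R = UNIV" using assms(1) by (auto simp: normalized_root_system_def)
    qed (use assms(4) A root_system_uminus[OF assms(1)] multiplicity_uminus[OF assms(1,3)] in auto)
    then show ?thesis by (simp add: ennreal_mult_less_top)
  qed
  finally have fin: "(\<integral>\<^sup>+x. ennreal ((norm (\<phi> x))\<^sup>2) \<partial>lborel) < \<infinity>" .
  show ?thesis
    using square_integrable_char_absolutely_continuous[OF prob sets_\<mu> \<phi> fin]
      square_integrable_char_density[OF prob sets_\<mu> \<phi> fin] by blast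
qed

end
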